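(* Let $R$ be a ring (not necessarily with $1$) and let $\pi:R\to\overline{R}:=R/\mathrm{rad}(R)$, $r\mapsto\bar r:=r+\mathrm{rad}(R)$, where $\mathrm{rad}(R)$ is the Jacobson radical of $R$. Let $G$ be a finite subgroup of $\mathrm{Aut}(R)$ and let $\overline{G}$ be its image under the group homomorphism $\mathrm{Aut}(R)\to\mathrm{Aut}(\overline{R})$, $g\mapsto\overline{g}$, where $\overline{g}(\bar r)=\overline{g(r)}$. Suppose that $\overline{R^G}=\overline{R}^{\,\overline{G}}$, where $\overline{R^G}=\pi(R^G)$, that the group $\overline{G}$ is either a left or a right proper splitting group for the ring $\overline{R}$, and that either 1. the ring $\overline{R}$ is $|\overline{G}|$-torsion free, or 2. $\mathcal{B}(\overline{R},\overline{G})\neq\emptyset$ and for every $p\in\mathcal{B}(\overline{R},\overline{G})$ the group $\overline{G}$ has a $p$-normal complement and the ring $\overline{R}^{\,\overline{G}}$ is $|\overline{G}|$-torsion free. Then $\mathrm{rad}(R^G)=\mathrm{rad}(R)\cap R^G$.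
   Context: Rings are associative and need not have an identity. $\mathrm{Aut}(R)$ is the group of ring automorphisms of $R$. For a group $H$ acting on a ring $S$ by automorphisms, $S^H=\{s\in S : g(s)=s\text{ for all }g\in H\}$ is the ring of $H$-invariants. For a natural number $k\ge 1$, $\mathrm{tor}_k(S)=\{s\in S : k^i s=0\text{ for some } i\geq 1\}$, and $S$ is called $k$-torsion free if $\mathrm{tor}_k(S)=0$. For a ring $S$ and a finite subgroup $H$ of $\mathrm{Aut}(S)$, the set of bad primes $\mathcal{B}(S,H)$ is the set of primes $p$ such that $p$ divides $|H|$ and $\mathrm{tor}_p(S)\neq 0$. If $p$ is a prime dividing $|H|$ and $|H|=p^s m$ with $s\geq 1$ and $p\nmid m$, a $p$-normal complement of $H$ is a normal subgroup of $H$ of order $m$. Let $S$ be a ring and $H$ a subgroup of $\mathrm{Aut}(S)$. A direct sum decomposition $S=S^H\oplus B$ of $S^H$-bimodules, with $e:S\to S^H$ the projection onto $S^H$ along $B$, is called a left (respectively, right) proper splitting if $e(I)\subseteq I\cap S^H$ for all left (respectively, right) $H$-invariant ideals $I$ of $S$. The group $H$ is called a left (respectively, right) proper splitting group for $S$ if there is at least one left (respectively, right) proper splitting. *)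

theory Defs
  imports "HOL-Algebra.QuotRing" "HOL-Algebra.Bij" "HOL-Computational_Algebra.Primes"
begin

text \<open>
  Rings need not have an identity.  They are carried by the record type of HOL-Algebra, whose
  component \<^const>\<open>one\<close> is left unconstrained and is never used.
\<close>

locale rng = abelian_group R for R (structure) +
  assumes m_closed: "\<lbrakk>x \<in> carrier R; y \<in> carrier R\<rbrakk> \<Longrightarrow> x \<otimes> y \<in> carrier R"
    and m_assoc: "\<lbrakk>x \<in> carrier R; y \<in> carrier R; z \<in> carrier R\<rbrakk>
      \<Longrightarrow> (x \<otimes> y) \<otimes> z = x \<otimes> (y \<otimes> z)"
    and l_distr: "\<lbrakk>x \<in> carrier R; y \<in> carrier R; z \<in> carrier R\<rbrakk>
      \<Longrightarrow> (x \<oplus> y) \<otimes> z = x \<otimes> z \<oplus> y \<otimes> z"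
    and r_distr: "\<lbrakk>x \<in> carrier R; y \<in> carrier R; z \<in> carrier R\<rbrakk>
      \<Longrightarrow> z \<otimes> (x \<oplus> y) = z \<otimes> x \<oplus> z \<otimes> y"

definition left_ideal :: "'a set \<Rightarrow> ('a, 'b) ring_scheme \<Rightarrow> bool" where
  "left_ideal I R \<longleftrightarrow>
    additive_subgroup I R \<and> (\<forall>r\<in>carrier R. \<forall>x\<in>I. r \<otimes>\<^bsub>R\<^esub> x \<in> I)"

definition right_ideal :: "'a set \<Rightarrow> ('a, 'b) ring_scheme \<Rightarrow> bool" where
  "right_ideal I R \<longleftrightarrow>
    additive_subgroup I R \<and> (\<forall>r\<in>carrier R. \<forall>x\<in>I. x \<otimes>\<^bsub>R\<^esub> r \<in> I)"

text \<open>
  The Jacobson radical of a ring without identity is the intersection of its maximal modular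
  (also called regular) left ideals, and the whole ring if there are none.  In a ring with
  identity every left ideal is modular.
\<close>

definition modular_left_ideal :: "'a set \<Rightarrow> ('a, 'b) ring_scheme \<Rightarrow> bool" where
  "modular_left_ideal M R \<longleftrightarrow>
    left_ideal M R \<and> (\<exists>e\<in>carrier R. \<forall>x\<in>carrier R. x \<ominus>\<^bsub>R\<^esub> x \<otimes>\<^bsub>R\<^esub> e \<in> M)"

definition maximal_left_ideal :: "'a set \<Rightarrow> ('a, 'b) ring_scheme \<Rightarrow> bool" where
  "maximal_left_ideal M R \<longleftrightarrow>
    left_ideal M R \<and> M \<noteq> carrier R \<and>
    (\<forall>J. left_ideal J R \<and> M \<subseteq> J \<longrightarrow> J = M \<or> J = carrier R)"

definition jacobson_radical :: "('a, 'b) ring_scheme \<Rightarrow> 'a set" where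
  "jacobson_radical R = {x \<in> carrier R.
    \<forall>M. maximal_left_ideal M R \<and> modular_left_ideal M R \<longrightarrow> x \<in> M}"

text \<open>
  As for \<^const>\<open>BijGroup\<close>, automorphisms are extensional functions, so that distinct elements
  of the automorphism group are distinct maps on the carrier.
\<close>

definition rng_auto :: "('a, 'b) ring_scheme \<Rightarrow> ('a \<Rightarrow> 'a) set" where
  "rng_auto R = {g \<in> Bij (carrier R). \<forall>x\<in>carrier R. \<forall>y\<in>carrier R.
    g (x \<oplus>\<^bsub>R\<^esub> y) = g x \<oplus>\<^bsub>R\<^esub> g y \<and> g (x \<otimes>\<^bsub>R\<^esub> y) = g x \<otimes>\<^bsub>R\<^esub> g y}"

definition rng_AutoGroup :: "('a, 'b) ring_scheme \<Rightarrow> ('a \<Rightarrow> 'a) monoid" where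
  "rng_AutoGroup R = BijGroup (carrier R) \<lparr>carrier := rng_auto R\<rparr>"

definition invariants :: "('a, 'b) ring_scheme \<Rightarrow> ('a \<Rightarrow> 'a) set \<Rightarrow> 'a set" where
  "invariants S H = {s \<in> carrier S. \<forall>g\<in>H. g s = s}"

definition invariant_ring ::
    "('a, 'b) ring_scheme \<Rightarrow> ('a \<Rightarrow> 'a) set \<Rightarrow> ('a, 'b) ring_scheme" where
  "invariant_ring S H = S \<lparr>carrier := invariants S H\<rparr>"

definition tor :: "nat \<Rightarrow> ('a, 'b) ring_scheme \<Rightarrow> 'a set" where
  "tor k S = {s \<in> carrier S. \<exists>i::nat. i \<ge> 1 \<and> [(k ^ i)] \<cdot>\<^bsub>S\<^esub> s = \<zero>\<^bsub>S\<^esub>}"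

definition torsion_free :: "nat \<Rightarrow> ('a, 'b) ring_scheme \<Rightarrow> bool" where
  "torsion_free k S \<longleftrightarrow> tor k S = {\<zero>\<^bsub>S\<^esub>}"

definition bad_primes :: "('a, 'b) ring_scheme \<Rightarrow> ('a \<Rightarrow> 'a) set \<Rightarrow> nat set" where
  "bad_primes S H = {p. prime p \<and> p dvd card H \<and> tor p S \<noteq> {\<zero>\<^bsub>S\<^esub>}}"

text \<open>The group \<open>H\<close> is a subgroup of the group \<open>A\<close>.\<close>

definition has_p_normal_complement :: "nat \<Rightarrow> 'g set \<Rightarrow> ('g, 'c) monoid_scheme \<Rightarrow> bool" where
  "has_p_normal_complement p H A \<longleftrightarrow>
    (\<exists>N s m. s \<ge> 1 \<and> card H = p ^ s * m \<and> \<not> p dvd m \<and>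
      N \<lhd> A\<lparr>carrier := H\<rparr> \<and> card N = m)"

definition bimodule_complement :: "('a, 'b) ring_scheme \<Rightarrow> 'a set \<Rightarrow> 'a set \<Rightarrow> bool" where
  "bimodule_complement S A B \<longleftrightarrow>
    additive_subgroup B S \<and>
    (\<forall>a\<in>A. \<forall>b\<in>B. a \<otimes>\<^bsub>S\<^esub> b \<in> B \<and> b \<otimes>\<^bsub>S\<^esub> a \<in> B) \<and>
    A <+>\<^bsub>S\<^esub> B = carrier S \<and> A \<inter> B = {\<zero>\<^bsub>S\<^esub>}"

definition projection_along ::
    "('a, 'b) ring_scheme \<Rightarrow> 'a set \<Rightarrow> 'a set \<Rightarrow> 'a \<Rightarrow> 'a" where
  "projection_along S A B s = (THE a. a \<in> A \<and> (\<exists>b\<in>B. s = a \<oplus>\<^bsub>S\<^esub> b))"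

definition invariant_subset :: "('a \<Rightarrow> 'a) set \<Rightarrow> 'a set \<Rightarrow> bool" where
  "invariant_subset H I \<longleftrightarrow> (\<forall>g\<in>H. g ` I = I)"

definition left_proper_splitting ::
    "('a, 'b) ring_scheme \<Rightarrow> ('a \<Rightarrow> 'a) set \<Rightarrow> 'a set \<Rightarrow> bool" where
  "left_proper_splitting S H B \<longleftrightarrow>
    bimodule_complement S (invariants S H) B \<and>
    (\<forall>I. left_ideal I S \<and> invariant_subset H I \<longrightarrow>
      projection_along S (invariants S H) B ` I \<subseteq> I \<inter> invariants S H)"

definition right_proper_splitting ::
    "('a, 'b) ring_scheme \<Rightarrow> ('a \<Rightarrow> 'a) set \<Rightarrow> 'a set \<Rightarrow> bool" where
  "right_proper_splitting S H B \<longleftrightarrow>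
    bimodule_complement S (invariants S H) B \<and>
    (\<forall>I. right_ideal I S \<and> invariant_subset H I \<longrightarrow>
      projection_along S (invariants S H) B ` I \<subseteq> I \<inter> invariants S H)"

definition left_proper_splitting_group ::
    "('a, 'b) ring_scheme \<Rightarrow> ('a \<Rightarrow> 'a) set \<Rightarrow> bool" where
  "left_proper_splitting_group S H \<longleftrightarrow> (\<exists>B. left_proper_splitting S H B)"

definition right_proper_splitting_group ::
    "('a, 'b) ring_scheme \<Rightarrow> ('a \<Rightarrow> 'a) set \<Rightarrow> bool" where
  "right_proper_splitting_group S H \<longleftrightarrow> (\<exists>B. right_proper_splitting S H B)"

definition rad_quotient :: "('a, 'b) ring_scheme \<Rightarrow> 'a set ring" where
  "rad_quotient R = R Quot jacobson_radical R"

definition rad_proj :: "('a, 'b) ring_scheme \<Rightarrow> 'a \<Rightarrow> 'a set" where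
  "rad_proj R r = jacobson_radical R +>\<^bsub>R\<^esub> r"

text \<open>
  The automorphism induced on a quotient is defined through representatives, in the same way as
  \<^const>\<open>rcoset_mult\<close>; the lemma below gives its value on the class of an element.
\<close>

definition induced_map ::
    "('a, 'b) ring_scheme \<Rightarrow> 'a set \<Rightarrow> ('a \<Rightarrow> 'a) \<Rightarrow> 'a set \<Rightarrow> 'a set" where
  "induced_map R I g = (\<lambda>C\<in>carrier (R Quot I). \<Union>r\<in>C. I +>\<^bsub>R\<^esub> g r)"

lemma (in rng) induced_map_coset:
  assumes I: "additive_subgroup I R" and g: "g \<in> rng_auto R" "g ` I \<subseteq> I"
    and r: "r \<in> carrier R"
  shows "induced_map R I g (I +> r) = I +> g r"
proof -
  interpret I: additive_subgroup I R by (rule I)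
  interpret I: abelian_subgroup I R
    by (rule abelian_subgroupI3[OF I]) unfold_locales
  have gc: "g x \<in> carrier R" if "x \<in> carrier R" for x
    using g(1) that Bij_imp_funcset[of g "carrier R"] unfolding rng_auto_def by blast
  have C: "I +> r \<in> carrier (R Quot I)"
    using r by (auto simp: FactRing_def intro: a_rcosetsI I.a_subset)
  have "I +> g x = I +> g r" if x: "x \<in> I +> r" for x
  proof -
    obtain i where i: "i \<in> I" "x = i \<oplus> r"
      using x by (auto simp: a_r_coset_def')
    moreover have "i \<in> carrier R"
      using i I.a_subset by blast
    ultimately have "g x = g i \<oplus> g r"
      using g(1) r unfolding rng_auto_def by blast
    moreover have "g i \<in> I" using i g(2) by blast
    ultimately have "g x \<in> I +> g r"
      unfolding a_r_coset_def' by blast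
    from a_repr_independence[OF this gc[OF r] I.a_subgroup] show ?thesis
      by (rule sym)
  qed
  moreover have "r \<in> I +> r" using r by (rule I.a_rcos_self)
  ultimately show ?thesis
    unfolding induced_map_def restrict_apply'[OF C] by blast
qed

definition induced_group ::
    "('a, 'b) ring_scheme \<Rightarrow> ('a \<Rightarrow> 'a) set \<Rightarrow> ('a set \<Rightarrow> 'a set) set" where
  "induced_group R G = induced_map R (jacobson_radical R) ` G"

end

theory Submission
  imports Defs
begin

text \<open>
  Put \<open>S = R / rad R\<close> and let \<open>H\<close> be the image of \<open>G\<close>.  For every finite group \<open>H\<close> of automorphisms of a
  ring \<open>S\<close> one has \<open>|H| rad(S\<^sup>H) \<subseteq> rad S\<close>; here \<open>rad S = 0\<close>, and either torsion hypothesis makes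
  \<open>S\<^sup>H\<close> free of \<open>|H|\<close>-torsion, so \<open>rad(S\<^sup>H) = 0\<close>.  As \<open>\<pi>\<close> maps \<open>R\<^sup>G\<close> onto \<open>S\<^sup>H\<close>, it kills \<open>rad(R\<^sup>G)\<close>.
  For the inclusion, let \<open>a \<in> rad(S\<^sup>H)\<close>, let \<open>S / M\<close> be a simple module on which \<open>|H|\<close> is invertible, and
  let \<open>z = a w\<close> in \<open>S / M\<close>.  The vectors \<open>(h(s) z)\<^sub>h\<close> form a submodule of the semisimple module
  \<open>\<Oplus>\<^sub>h S / M\<close> twisted by the \<open>h\<close>; projecting the constant vector \<open>w / |H|\<close> to it yields \<open>s\<close> with
  \<open>z = |H| a h(s) z\<close> for all \<open>h\<close>.  Summing, \<open>z = a t z\<close> with \<open>t = \<Sum>\<^sub>h h(s) \<in> S\<^sup>H\<close>, and \<open>z = 0\<close> because \<open>t a\<close> is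
  quasi-regular.  Conversely \<open>rad(R) \<inter> R\<^sup>G\<close> is quasi-regular in \<open>R\<^sup>G\<close> because quasi-inverses are unique.
\<close>

section \<open>Rings without identity\<close>

context rng
begin

lemma l_null: assumes "x \<in> carrier R" shows "\<zero> \<otimes> x = \<zero>"
proof -
  have "\<zero> \<otimes> x \<oplus> \<zero> \<otimes> x = \<zero> \<otimes> x \<oplus> \<zero>"
    using l_distr[of \<zero> \<zero> x] assms by (simp add: m_closed)
  then show ?thesis using assms by (simp add: m_closed)
qed

lemma r_null: assumes "x \<in> carrier R" shows "x \<otimes> \<zero> = \<zero>"
proof -
  have "x \<otimes> \<zero> \<oplus> x \<otimes> \<zero> = x \<otimes> \<zero> \<oplus> \<zero>"
    using r_distr[of \<zero> \<zero> x] assms by (simp add: m_closed)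
  then show ?thesis using assms by (simp add: m_closed)
qed

lemma l_minus: assumes "x \<in> carrier R" "y \<in> carrier R" shows "(\<ominus> x) \<otimes> y = \<ominus> (x \<otimes> y)"
proof -
  have "(\<ominus> x) \<otimes> y \<oplus> x \<otimes> y = \<zero>"
    using l_distr[of "\<ominus> x" x y] assms by (simp add: l_null l_neg)
  then show ?thesis using assms by (metis minus_equality m_closed a_inv_closed)
qed

lemma r_minus: assumes "x \<in> carrier R" "y \<in> carrier R" shows "x \<otimes> (\<ominus> y) = \<ominus> (x \<otimes> y)"
proof -
  have "x \<otimes> (\<ominus> y) \<oplus> x \<otimes> y = \<zero>"
    using r_distr[of "\<ominus> y" y x] assms by (simp add: r_null l_neg)
  then show ?thesis using assms by (metis minus_equality m_closed a_inv_closed)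
qed

lemma minus_zero: "\<ominus> \<zero> = \<zero>"
  by (simp add: minus_equality)

text \<open>Sorting a sum may leave another summand between \<open>x\<close> and its negative; this
  rule cancels the pair across it.\<close>

lemma r_neg_lcomm: "\<lbrakk>x \<in> carrier R; y \<in> carrier R; z \<in> carrier R\<rbrakk>
    \<Longrightarrow> x \<oplus> (y \<oplus> (\<ominus> x \<oplus> z)) = y \<oplus> z"
  by (metis a_lcomm r_neg2 a_closed a_inv_closed)

lemmas rng_simps = a_minus_def l_distr r_distr m_assoc l_minus r_minus minus_add a_ac
  r_neg1 r_neg2 r_neg l_neg m_closed

lemma diff_mult: "\<lbrakk>x \<in> carrier R; y \<in> carrier R; z \<in> carrier R\<rbrakk>
    \<Longrightarrow> (x \<ominus> y) \<otimes> z = x \<otimes> z \<ominus> y \<otimes> z"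
  by (simp add: rng_simps)

lemma mult_diff: "\<lbrakk>x \<in> carrier R; y \<in> carrier R; z \<in> carrier R\<rbrakk>
    \<Longrightarrow> z \<otimes> (x \<ominus> y) = z \<otimes> x \<ominus> z \<otimes> y"
  by (simp add: rng_simps)

lemma add_pow_mult: assumes "x \<in> carrier R" "y \<in> carrier R"
  shows "[(n::nat)] \<cdot> x \<otimes> y = [n] \<cdot> (x \<otimes> y)"
  using assms by (induction n) (simp_all add: l_null l_distr m_closed)

lemma mult_add_pow: assumes "x \<in> carrier R" "y \<in> carrier R"
  shows "x \<otimes> [(n::nat)] \<cdot> y = [n] \<cdot> (x \<otimes> y)"
  using assms by (induction n) (simp_all add: r_null r_distr m_closed)

lemma add_pow_diff: assumes "x \<in> carrier R" "y \<in> carrier R"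
  shows "[(n::nat)] \<cdot> (x \<ominus> y) = [n] \<cdot> x \<ominus> [n] \<cdot> y"
  using assms by (induction n) (simp_all add: rng_simps)

section \<open>Left ideals\<close>

lemma left_idealI:
  assumes "I \<subseteq> carrier R" "\<zero> \<in> I"
    and "\<And>x y. \<lbrakk>x \<in> I; y \<in> I\<rbrakk> \<Longrightarrow> x \<ominus> y \<in> I"
    and "\<And>r x. \<lbrakk>r \<in> carrier R; x \<in> I\<rbrakk> \<Longrightarrow> r \<otimes> x \<in> I"
  shows "left_ideal I R"
proof -
  have inv: "\<ominus> x \<in> I" if "x \<in> I" for x
    using assms(3)[OF assms(2) that] assms(1) that by (auto simp: a_minus_def)
  have add: "x \<oplus> y \<in> I" if "x \<in> I" "y \<in> I" for x y
    using assms(3)[OF that(1) inv[OF that(2)]] assms(1) that by (auto simp: a_minus_def)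
  have "subgroup I (add_monoid R)"
    using assms(1,2) inv add
    by (intro add.subgroupI) (auto simp: a_inv_def)
  then show ?thesis
    using assms(4) by (auto simp: left_ideal_def additive_subgroup_def)
qed

lemma left_idealD:
  assumes "left_ideal I R"
  shows left_ideal_subset: "I \<subseteq> carrier R"
    and left_ideal_zero: "\<zero> \<in> I"
    and left_ideal_add: "\<And>x y. \<lbrakk>x \<in> I; y \<in> I\<rbrakk> \<Longrightarrow> x \<oplus> y \<in> I"
    and left_ideal_inv: "\<And>x. x \<in> I \<Longrightarrow> \<ominus> x \<in> I"
    and left_ideal_diff: "\<And>x y. \<lbrakk>x \<in> I; y \<in> I\<rbrakk> \<Longrightarrow> x \<ominus> y \<in> I"
    and left_ideal_mult: "\<And>r x. \<lbrakk>r \<in> carrier R; x \<in> I\<rbrakk> \<Longrightarrow> r \<otimes> x \<in> I"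
proof -
  interpret additive_subgroup I R using assms by (simp add: left_ideal_def)
  have inv: "\<ominus> x \<in> I" if "x \<in> I" for x
    using a_subgroup that subgroup.m_inv_closed[of I "add_monoid R" x] by (simp add: a_inv_def)
  show "I \<subseteq> carrier R" "\<zero> \<in> I" by (auto simp: a_subset)
  show "\<And>x y. \<lbrakk>x \<in> I; y \<in> I\<rbrakk> \<Longrightarrow> x \<oplus> y \<in> I" by simp
  show "\<And>x. x \<in> I \<Longrightarrow> \<ominus> x \<in> I" by (rule inv)
  then show "\<And>x y. \<lbrakk>x \<in> I; y \<in> I\<rbrakk> \<Longrightarrow> x \<ominus> y \<in> I" by (simp add: a_minus_def)
  show "\<And>r x. \<lbrakk>r \<in> carrier R; x \<in> I\<rbrakk> \<Longrightarrow> r \<otimes> x \<in> I"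
    using assms by (simp add: left_ideal_def)
qed

text \<open>Congruence modulo \<open>I\<close> is written as membership of a difference throughout;
  since \<open>x = (x - y) + y\<close>, membership passes along such a congruence.\<close>

lemma left_ideal_diff_cancel:
  assumes "left_ideal I R" "x \<in> carrier R" "y \<in> I" "x \<ominus> y \<in> I"
  shows "x \<in> I"
proof -
  have "x = (x \<ominus> y) \<oplus> y"
    using assms(2,3) left_ideal_subset[OF assms(1)] by (auto simp: rng_simps)
  then show ?thesis using left_ideal_add[OF assms(1,4,3)] by simp
qed

lemma left_ideal_add_pow:
  assumes "left_ideal I R" "x \<in> I" shows "[(n::nat)] \<cdot> x \<in> I"
  by (induction n) (simp_all add: left_idealD[OF assms(1)] assms)

lemma left_ideal_sum:
  assumes I: "left_ideal I R" and J: "left_ideal J R"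
  shows "left_ideal (I <+>\<^bsub>R\<^esub> J) R"
proof (rule left_idealI)
  note I_sub = left_ideal_subset[OF I] and J_sub = left_ideal_subset[OF J]
  show "I <+>\<^bsub>R\<^esub> J \<subseteq> carrier R" using I_sub J_sub by (auto simp: set_add_def')
  show "\<zero> \<in> I <+>\<^bsub>R\<^esub> J"
    using left_ideal_zero[OF I] left_ideal_zero[OF J] by (force simp: set_add_def')
  fix x y assume "x \<in> I <+>\<^bsub>R\<^esub> J" "y \<in> I <+>\<^bsub>R\<^esub> J"
  then obtain i j i' j' where ij: "i \<in> I" "j \<in> J" "i' \<in> I" "j' \<in> J" "x = i \<oplus> j" "y = i' \<oplus> j'"
    by (auto simp: set_add_def')
  then have "x \<ominus> y = (i \<ominus> i') \<oplus> (j \<ominus> j')"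
    using I_sub J_sub by (auto simp: rng_simps subset_iff)
  then show "x \<ominus> y \<in> I <+>\<^bsub>R\<^esub> J"
    using left_ideal_diff[OF I ij(1,3)] left_ideal_diff[OF J ij(2,4)] by (auto simp: set_add_def')
next
  fix r x assume r: "r \<in> carrier R" and "x \<in> I <+>\<^bsub>R\<^esub> J"
  then obtain i j where ij: "i \<in> I" "j \<in> J" "x = i \<oplus> j" by (auto simp: set_add_def')
  then have "r \<otimes> x = r \<otimes> i \<oplus> r \<otimes> j"
    using r left_ideal_subset[OF I] left_ideal_subset[OF J] by (blast intro: r_distr)
  then show "r \<otimes> x \<in> I <+>\<^bsub>R\<^esub> J"
    using left_ideal_mult[OF I r ij(1)] left_ideal_mult[OF J r ij(2)] by (auto simp: set_add_def')
qed

lemma left_ideal_sum_supset: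
  assumes "left_ideal I R" "left_ideal J R"
  shows "I \<subseteq> I <+>\<^bsub>R\<^esub> J" "J \<subseteq> I <+>\<^bsub>R\<^esub> J"
proof -
  have "x \<in> I <+>\<^bsub>R\<^esub> J" if "x \<in> I" for x
  proof -
    have "x = x \<oplus> \<zero>" using left_ideal_subset[OF assms(1)] that by auto
    then show ?thesis using that left_ideal_zero[OF assms(2)] by (auto simp: set_add_def')
  qed
  moreover have "x \<in> I <+>\<^bsub>R\<^esub> J" if "x \<in> J" for x
  proof -
    have "x = \<zero> \<oplus> x" using left_ideal_subset[OF assms(2)] that by auto
    then show ?thesis using that left_ideal_zero[OF assms(1)] by (auto simp: set_add_def')
  qed
  ultimately show "I \<subseteq> I <+>\<^bsub>R\<^esub> J" "J \<subseteq> I <+>\<^bsub>R\<^esub> J" by auto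
qed

text \<open>Without an identity, \<open>R x\<close> need not contain \<open>x\<close>; its use in
  \<open>max_modular_simple\<close> first finds some \<open>r x\<close> outside
  \<open>M\<close>.\<close>

lemma left_ideal_principal:
  assumes "x \<in> carrier R" shows "left_ideal ((\<lambda>r. r \<otimes> x) ` carrier R) R"
proof (rule left_idealI)
  show "\<zero> \<in> (\<lambda>r. r \<otimes> x) ` carrier R" by (rule image_eqI[of _ _ \<zero>]) (simp_all add: l_null assms)
next
  fix u v assume "u \<in> (\<lambda>r. r \<otimes> x) ` carrier R" "v \<in> (\<lambda>r. r \<otimes> x) ` carrier R"
  then obtain r s where "r \<in> carrier R" "s \<in> carrier R" "u = r \<otimes> x" "v = s \<otimes> x" by auto
  then have "u \<ominus> v = (r \<ominus> s) \<otimes> x" "r \<ominus> s \<in> carrier R" using assms by (simp_all add: diff_mult)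
  then show "u \<ominus> v \<in> (\<lambda>r. r \<otimes> x) ` carrier R" by auto
next
  fix r u assume "r \<in> carrier R" "u \<in> (\<lambda>r. r \<otimes> x) ` carrier R"
  then obtain s where "r \<in> carrier R" "s \<in> carrier R" "u = s \<otimes> x" by auto
  then have "r \<otimes> u = (r \<otimes> s) \<otimes> x" "r \<otimes> s \<in> carrier R" using assms by (simp_all add: m_assoc m_closed)
  then show "r \<otimes> u \<in> (\<lambda>r. r \<otimes> x) ` carrier R" by auto
qed (auto simp: assms m_closed)

section \<open>Maximal modular left ideals \<open>M\<close> and the simple modules
  \<open>R / M\<close>\<close>

definition max_modular :: "'a set \<Rightarrow> bool" where
  "max_modular M \<longleftrightarrow> maximal_left_ideal M R \<and> modular_left_ideal M R"

lemma max_modularD: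
  assumes "max_modular M"
  shows max_modular_left_ideal: "left_ideal M R"
    and max_modular_proper: "M \<noteq> carrier R"
    and max_modular_maximal: "\<And>J. \<lbrakk>left_ideal J R; M \<subseteq> J\<rbrakk> \<Longrightarrow> J = M \<or> J = carrier R"
    and max_modular_unit: "\<exists>e\<in>carrier R. \<forall>x\<in>carrier R. x \<ominus> x \<otimes> e \<in> M"
  using assms by (auto simp: max_modular_def maximal_left_ideal_def modular_left_ideal_def)

lemma max_modularI:
  assumes "left_ideal M R" "M \<noteq> carrier R"
    and "\<And>J. \<lbrakk>left_ideal J R; M \<subseteq> J; J \<noteq> M\<rbrakk> \<Longrightarrow> carrier R \<subseteq> J"
    and "e \<in> carrier R" "\<And>x. x \<in> carrier R \<Longrightarrow> x \<ominus> x \<otimes> e \<in> M"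
  shows "max_modular M"
  using assms left_ideal_subset
  unfolding max_modular_def maximal_left_ideal_def modular_left_ideal_def by blast

lemma jacobson_radical_iff:
  "x \<in> jacobson_radical R \<longleftrightarrow> x \<in> carrier R \<and> (\<forall>M. max_modular M \<longrightarrow> x \<in> M)"
  by (auto simp: jacobson_radical_def max_modular_def)

text \<open>A modular unit inside \<open>M\<close> would give \<open>x e\<close> in
  \<open>M\<close>, hence \<open>x\<close> in \<open>M\<close>, for all \<open>x\<close>, against
  properness.\<close>

lemma max_modular_unit_notin:
  assumes M: "max_modular M" and e: "e \<in> carrier R" "\<And>x. x \<in> carrier R \<Longrightarrow> x \<ominus> x \<otimes> e \<in> M"
  shows "e \<notin> M"
proof
  note L = max_modular_left_ideal[OF M]
  assume "e \<in> M"
  then have "x \<in> M" if "x \<in> carrier R" for x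
    using left_ideal_diff_cancel[OF L that left_ideal_mult[OF L that]] e(2)[OF that] by blast
  then show False using max_modular_proper[OF M] left_ideal_subset[OF L] by blast
qed

text \<open>No nonzero vector of \<open>R / M\<close> is killed by all of \<open>R\<close>. The
  killed vectors form a left ideal \<open>N\<close> between \<open>M\<close> and \<open>R\<close>,
  and \<open>N = R\<close> would put \<open>e e\<close>, hence the modular unit \<open>e\<close>,
  into \<open>M\<close>.\<close>

lemma max_modular_annihilated:
  assumes M: "max_modular M" and x: "x \<in> carrier R" and ann: "\<And>r. r \<in> carrier R \<Longrightarrow> r \<otimes> x \<in> M"
  shows "x \<in> M"
proof -
  note L = max_modular_left_ideal[OF M]
  define N where "N = {y \<in> carrier R. \<forall>r\<in>carrier R. r \<otimes> y \<in> M}"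
  obtain e where e: "e \<in> carrier R" "\<And>y. y \<in> carrier R \<Longrightarrow> y \<ominus> y \<otimes> e \<in> M"
    using max_modular_unit[OF M] by auto
  have "left_ideal N R"
    by (rule left_idealI)
      (auto simp: N_def m_closed mult_diff r_null left_idealD[OF L] m_assoc[symmetric])
  moreover have "M \<subseteq> N" using left_ideal_mult[OF L] left_ideal_subset[OF L] by (auto simp: N_def)
  ultimately have "N = M \<or> N = carrier R" using max_modular_maximal[OF M] by blast
  moreover have "N \<noteq> carrier R"
  proof
    assume "N = carrier R"
    then have "e \<otimes> e \<in> M" using e(1) by (auto simp: N_def)
    then have "e \<in> M" using left_ideal_diff_cancel[OF L e(1) _ e(2)[OF e(1)]] by blast
    then show False using max_modular_unit_notin[OF M e] by blast
  qed
  ultimately show ?thesis using x ann by (auto simp: N_def)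
qed

text \<open>Simplicity of \<open>R / M\<close>: some \<open>r x\<close> lies outside
  \<open>M\<close> by \<open>max_modular_annihilated\<close>, so \<open>M + R x\<close> is strictly
  larger than \<open>M\<close> and must be \<open>R\<close>.\<close>

lemma max_modular_simple:
  assumes M: "max_modular M" and x: "x \<in> carrier R" "x \<notin> M" and w: "w \<in> carrier R"
  shows "\<exists>r\<in>carrier R. w \<ominus> r \<otimes> x \<in> M"
proof -
  note L = max_modular_left_ideal[OF M]
  note P = left_ideal_principal[OF x(1)]
  obtain r where r: "r \<in> carrier R" "r \<otimes> x \<notin> M" using max_modular_annihilated[OF M x(1)] x(2) by blast
  let ?J = "M <+>\<^bsub>R\<^esub> (\<lambda>r. r \<otimes> x) ` carrier R"
  have "?J = carrier R"
    using max_modular_maximal[OF M left_ideal_sum[OF L P] left_ideal_sum_supset(1)[OF L P]]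
      left_ideal_sum_supset(2)[OF L P] r by blast
  then have "w \<in> ?J" using w by simp
  then obtain m s where ms: "m \<in> M" "s \<in> carrier R" "w = m \<oplus> s \<otimes> x"
    by (auto simp: set_add_def')
  then have "w \<ominus> s \<otimes> x = m"
    using x left_ideal_subset[OF L] by (auto simp: rng_simps subset_iff)
  then show ?thesis using ms(1,2) by metis
qed

text \<open>Schur's lemma for multiplication by \<open>n\<close> on \<open>R / M\<close>: the kernel
  is \<open>N / M\<close>, so the map is zero, or it is injective and then, its image being a
  nonzero submodule, surjective.\<close>

lemma max_modular_torsion:
  assumes M: "max_modular M"
  obtains "\<And>x. x \<in> carrier R \<Longrightarrow> [(n::nat)] \<cdot> x \<in> M"
  | "\<And>x. \<lbrakk>x \<in> carrier R; [n] \<cdot> x \<in> M\<rbrakk> \<Longrightarrow> x \<in> M"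
    "\<And>w. w \<in> carrier R \<Longrightarrow> \<exists>v\<in>carrier R. w \<ominus> [n] \<cdot> v \<in> M"
proof -
  note L = max_modular_left_ideal[OF M]
  define N where "N = {x \<in> carrier R. [n] \<cdot> x \<in> M}"
  have "left_ideal N R"
    by (rule left_idealI)
      (auto simp: N_def m_closed add_pow_diff left_idealD[OF L] mult_add_pow[symmetric])
  moreover have "M \<subseteq> N" using left_ideal_add_pow[OF L] left_ideal_subset[OF L] by (auto simp: N_def)
  ultimately consider "N = carrier R" | "N = M" "N \<noteq> carrier R"
    using max_modular_maximal[OF M] by blast
  then show thesis
  proof cases
    case 1
    then show thesis using that(1) by (auto simp: N_def)
  next
    case 2
    have P: "left_ideal ((\<lambda>v. [n] \<cdot> v) ` carrier R) R"
    proof (rule left_idealI)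
      show "\<zero> \<in> (\<lambda>v. [n] \<cdot> v) ` carrier R" by (rule image_eqI[of _ _ \<zero>]) simp_all
    qed (auto simp: add_pow_diff[symmetric] mult_add_pow m_closed)
    let ?J = "M <+>\<^bsub>R\<^esub> (\<lambda>v. [n] \<cdot> v) ` carrier R"
    have "?J \<noteq> M" using left_ideal_sum_supset(2)[OF L P] 2(2) by (auto simp: N_def)
    then have J: "?J = carrier R"
      using max_modular_maximal[OF M left_ideal_sum[OF L P] left_ideal_sum_supset(1)[OF L P]] by blast
    have "\<exists>v\<in>carrier R. w \<ominus> [n] \<cdot> v \<in> M" if "w \<in> carrier R" for w
    proof -
      have "w \<in> ?J" using that J by simp
      then obtain m v where mv: "m \<in> M" "v \<in> carrier R" "w = m \<oplus> [n] \<cdot> v"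
        by (auto simp: set_add_def')
      then have "w \<ominus> [n] \<cdot> v = m"
        using left_ideal_subset[OF L] by (auto simp: rng_simps subset_iff)
      then show ?thesis using mv(1,2) by metis
    qed
    then show thesis using that(2) 2(1) by (auto simp: N_def)
  qed
qed

text \<open>Zorn's lemma on the left ideals that contain \<open>N\<close> and omit \<open>e\<close>.
  Above \<open>N\<close>, omitting \<open>e\<close> is the same as being proper, because
  \<open>x\<close> is congruent to \<open>x e\<close>; and omitting \<open>e\<close> visibly passes
  to unions of chains.\<close>

lemma modular_left_ideal_contained:
  assumes N: "left_ideal N R" "N \<noteq> carrier R"
    and e: "e \<in> carrier R" "\<And>x. x \<in> carrier R \<Longrightarrow> x \<ominus> x \<otimes> e \<in> N"
  shows "\<exists>M. max_modular M \<and> N \<subseteq> M"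
proof -
  define A where "A = {J. left_ideal J R \<and> N \<subseteq> J \<and> e \<notin> J}"
  have full: "carrier R \<subseteq> J" if "left_ideal J R" "N \<subseteq> J" "e \<in> J" for J
    using left_ideal_diff_cancel[OF that(1)] left_ideal_mult[OF that(1)] e that by blast
  have "N \<in> A" using full[of N] N left_ideal_subset[OF N(1)] by (auto simp: A_def)
  have chain: "\<Union>C \<in> A" if C: "C \<noteq> {}" "subset.chain A C" for C
  proof -
    have CA: "C \<subseteq> A" and tot: "\<And>X Y. X \<in> C \<Longrightarrow> Y \<in> C \<Longrightarrow> X \<subseteq> Y \<or> Y \<subseteq> X"
      using C(2) by (auto simp: subset_chain_def)
    have id: "left_ideal X R" if "X \<in> C" for X using CA that by (auto simp: A_def)
    have "left_ideal (\<Union>C) R"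
    proof (rule left_idealI)
      show "\<Union>C \<subseteq> carrier R" using id left_ideal_subset by blast
      show "\<zero> \<in> \<Union>C" using C(1) id left_ideal_zero by blast
      show "r \<otimes> x \<in> \<Union>C" if "r \<in> carrier R" "x \<in> \<Union>C" for r x
        using that id left_ideal_mult by blast
      show "x \<ominus> y \<in> \<Union>C" if xy: "x \<in> \<Union>C" "y \<in> \<Union>C" for x y
      proof -
        obtain X where "X \<in> C" "x \<in> X" "y \<in> X" using xy tot by blast
        then show ?thesis using id left_ideal_diff by blast
      qed
    qed
    then show "\<Union>C \<in> A" using CA C(1) by (auto simp: A_def)
  qed
  then obtain M where M: "M \<in> A" "\<And>X. X \<in> A \<Longrightarrow> M \<subseteq> X \<Longrightarrow> X = M"
    using subset_Zorn_nonempty[OF _ chain] \<open>N \<in> A\<close> by (metis empty_iff)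
  have "max_modular M"
  proof (rule max_modularI[OF _ _ _ e(1)])
    show "carrier R \<subseteq> J" if J: "left_ideal J R" "M \<subseteq> J" "J \<noteq> M" for J
    proof -
      have "e \<in> J" using M(2)[of J] J M(1) by (auto simp: A_def)
      then show ?thesis using full[OF J(1)] M(1) J(2) by (auto simp: A_def)
    qed
  qed (use M(1) e in \<open>auto simp: A_def\<close>)
  then show ?thesis using M(1) by (auto simp: A_def)
qed

section \<open>The Jacobson radical\<close>

lemma jacobson_radical_left_ideal: "left_ideal (jacobson_radical R) R"
  by (rule left_idealI)
    (use left_idealD max_modular_left_ideal in \<open>auto simp: jacobson_radical_iff m_closed\<close>)

text \<open>For \<open>r \<notin> M\<close>, right multiplication by \<open>r\<close> identifies \<open>R / {y. y r \<in> M}\<close> with \<open>R / M\<close>.\<close>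

lemma max_modular_quotient:
  assumes M: "max_modular M" and r: "r \<in> carrier R" "r \<notin> M"
  shows "max_modular {y \<in> carrier R. y \<otimes> r \<in> M}" (is "max_modular ?N")
proof -
  note L = max_modular_left_ideal[OF M]
  \<comment> \<open>With \<open>e r\<close> congruent to \<open>r\<close>, this \<open>e\<close> is
    a modular unit for the new ideal, since \<open>(x - x e) r = x (r - e r)\<close>.\<close>
  obtain e where e: "e \<in> carrier R" "r \<ominus> e \<otimes> r \<in> M"
    using max_modular_simple[OF M r r(1)] by blast
  show ?thesis
  proof (rule max_modularI[OF _ _ _ e(1)])
    show "left_ideal ?N R"
      by (rule left_idealI) (auto simp: m_closed l_null diff_mult r m_assoc left_idealD[OF L])
    show "?N \<noteq> carrier R" using max_modular_annihilated[OF M r(1)] r(2) by blast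
    show "carrier R \<subseteq> J" if J: "left_ideal J R" "?N \<subseteq> J" "J \<noteq> ?N" for J
    proof
      fix v assume v: "v \<in> carrier R"
      obtain y where y: "y \<in> J" "y \<in> carrier R" "y \<otimes> r \<notin> M"
        using J left_ideal_subset[OF J(1)] by blast
      obtain q where q: "q \<in> carrier R" "v \<otimes> r \<ominus> q \<otimes> (y \<otimes> r) \<in> M"
        using max_modular_simple[OF M _ y(3), of "v \<otimes> r"] r y v m_closed by blast
      then have "v \<ominus> q \<otimes> y \<in> ?N" using v y r by (simp add: diff_mult m_assoc m_closed)
      then show "v \<in> J"
        using left_ideal_diff_cancel[OF J(1) v left_ideal_mult[OF J(1) q(1) y(1)]] J(2) by blast
    qed
    show "x \<ominus> x \<otimes> e \<in> ?N" if x: "x \<in> carrier R" for x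
    proof -
      have "(x \<ominus> x \<otimes> e) \<otimes> r = x \<otimes> (r \<ominus> e \<otimes> r)"
        using x e(1) r(1) by (simp add: diff_mult mult_diff m_assoc m_closed)
      then show ?thesis using left_ideal_mult[OF L x e(2)] x e(1) by (simp add: m_closed)
    qed
  qed
qed

text \<open>Makes the radical two-sided, as the product on the quotient requires. For
  \<open>r\<close> outside \<open>M\<close>, membership of \<open>x r\<close> in \<open>M\<close> is
  membership of \<open>x\<close> in the maximal modular left ideal of
  \<open>max_modular_quotient\<close>.\<close>

lemma jacobson_radical_r_mult:
  assumes x: "x \<in> jacobson_radical R" and r: "r \<in> carrier R"
  shows "x \<otimes> r \<in> jacobson_radical R"
proof -
  have "x \<otimes> r \<in> M" if M: "max_modular M" for M
  proof (cases "r \<in> M")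
    case True
    then show ?thesis using left_ideal_mult[OF max_modular_left_ideal[OF M]] x
      by (auto simp: jacobson_radical_iff)
  next
    case False
    then show ?thesis using max_modular_quotient[OF M r] x by (auto simp: jacobson_radical_iff)
  qed
  then show ?thesis using x r by (auto simp: jacobson_radical_iff m_closed)
qed

text \<open>In terms of a formal identity, \<open>(1 + y) (1 - x) = 1\<close>.\<close>

lemma jacobson_radical_quasi_regular:
  assumes x: "x \<in> jacobson_radical R"
  shows "\<exists>y\<in>carrier R. y \<ominus> y \<otimes> x = x"
proof -
  have xc: "x \<in> carrier R" using x by (simp add: jacobson_radical_iff)
  \<comment> \<open>\<open>N\<close> is formally \<open>R (1 - x)\<close>, and \<open>x\<close> is a
    modular unit for it. If \<open>N\<close> were proper, a maximal modular left ideal above it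
    would have to omit \<open>x\<close>.\<close>
  define N where "N = (\<lambda>y. y \<ominus> y \<otimes> x) ` carrier R"
  have N: "left_ideal N R"
  proof (rule left_idealI)
    show "N \<subseteq> carrier R" using xc by (auto simp: N_def m_closed)
    show "\<zero> \<in> N" unfolding N_def
      by (rule image_eqI[of _ _ \<zero>]) (simp_all add: l_null xc minus_zero a_minus_def)
  next
    fix u v assume "u \<in> N" "v \<in> N"
    then obtain y y' where *: "y \<in> carrier R" "y' \<in> carrier R" "u = y \<ominus> y \<otimes> x" "v = y' \<ominus> y' \<otimes> x"
      by (auto simp: N_def)
    then have "u \<ominus> v = (y \<ominus> y') \<ominus> (y \<ominus> y') \<otimes> x" using xc by (simp add: rng_simps)
    then show "u \<ominus> v \<in> N" using * by (auto simp: N_def)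
  next
    fix r u assume r: "r \<in> carrier R" and "u \<in> N"
    then obtain y where *: "y \<in> carrier R" "u = y \<ominus> y \<otimes> x" by (auto simp: N_def)
    then have "r \<otimes> u = r \<otimes> y \<ominus> r \<otimes> y \<otimes> x" using xc r by (simp add: mult_diff m_assoc m_closed)
    then show "r \<otimes> u \<in> N" using * r by (auto simp: N_def m_closed)
  qed
  have mod: "y \<ominus> y \<otimes> x \<in> N" if "y \<in> carrier R" for y using that by (auto simp: N_def)
  have "N = carrier R"
  proof (rule ccontr)
    assume "N \<noteq> carrier R"
    then obtain M where M: "max_modular M" "N \<subseteq> M"
      using modular_left_ideal_contained[OF N _ xc mod] by blast
    then have "x \<notin> M" using max_modular_unit_notin[OF M(1) xc] mod by blast
    then show False using x M(1) by (auto simp: jacobson_radical_iff)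
  qed
  then obtain y where "y \<in> carrier R" "x = y \<ominus> y \<otimes> x" using xc unfolding N_def by blast
  then show ?thesis by metis
qed

text \<open>Formally, a left inverse \<open>1 + y\<close> of \<open>1 - x\<close> is also a right
  inverse: \<open>y\<close> lies in the radical, so \<open>1 + y\<close> has itself a left inverse
  \<open>1 + u\<close>, and this equals \<open>1 - x\<close>. A left inverse and a right inverse
  coincide.\<close>

lemma jacobson_radical_quasi_inverse_unique:
  assumes x: "x \<in> jacobson_radical R"
    and y: "y \<in> carrier R" "y \<ominus> y \<otimes> x = x" and y': "y' \<in> carrier R" "y' \<ominus> y' \<otimes> x = x"
  shows "y = y'"
proof -
  have xc: "x \<in> carrier R" using x by (simp add: jacobson_radical_iff)
  have y_eq: "y = x \<oplus> y \<otimes> x"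
    using arg_cong[OF y(2), of "\<lambda>u. u \<oplus> y \<otimes> x"] xc y(1) by (simp add: rng_simps)
  have y'_eq: "y' = x \<oplus> y' \<otimes> x"
    using arg_cong[OF y'(2), of "\<lambda>u. u \<oplus> y' \<otimes> x"] xc y'(1) by (simp add: rng_simps)
  note J = jacobson_radical_left_ideal
  have "y \<in> jacobson_radical R"
    using left_ideal_add[OF J x left_ideal_mult[OF J y(1) x]] y_eq by simp
  then have "\<ominus> y \<in> jacobson_radical R" by (rule left_ideal_inv[OF J])
  then obtain u where u: "u \<in> carrier R" "u \<ominus> u \<otimes> (\<ominus> y) = \<ominus> y"
    using jacobson_radical_quasi_regular by blast
  then have "u \<oplus> u \<otimes> y = \<ominus> y" using y(1) by (simp add: rng_simps)
  then have u_eq: "u \<oplus> u \<otimes> y \<oplus> y = \<zero>" using y(1) by (simp add: l_neg)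
  \<comment> \<open>Multiplies \<open>(1 + u) (1 + y) - 1 = 0\<close> on the right by
    \<open>1 - x\<close>; the equation for \<open>y\<close> collapses the result to
    \<open>u + x\<close>.\<close>
  have "\<zero> = (u \<oplus> u \<otimes> y \<oplus> y) \<ominus> (u \<oplus> u \<otimes> y \<oplus> y) \<otimes> x"
    using u_eq xc by (simp add: l_null a_minus_def minus_zero)
  also have "\<dots> = u \<oplus> (y \<ominus> y \<otimes> x) \<oplus> u \<otimes> (y \<ominus> y \<otimes> x) \<ominus> u \<otimes> x"
    using u(1) y(1) xc by (simp add: rng_simps)
  also have "\<dots> = u \<oplus> x"
    using u(1) xc unfolding y(2) by (simp add: rng_simps)
  finally have "u \<oplus> x = \<zero>" by simp
  then have u_x: "u = \<ominus> x" using u(1) xc by (metis minus_equality)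
  have xy: "y \<ominus> x \<otimes> y = x"
  proof -
    have "y \<ominus> x \<otimes> y = (u \<oplus> u \<otimes> y \<oplus> y) \<oplus> x"
      using xc y(1) unfolding u_x by (simp add: rng_simps r_neg_lcomm)
    then show ?thesis using u_eq xc by simp
  qed
  \<comment> \<open>Evaluates \<open>y' (1 - x) y\<close> in both bracketings.\<close>
  have "y' \<otimes> y \<ominus> y' \<otimes> x \<otimes> y = y' \<otimes> x"
    using arg_cong[OF xy, of "\<lambda>v. y' \<otimes> v"] xc y(1) y'(1) by (simp add: mult_diff m_closed m_assoc)
  moreover have "y' \<otimes> y \<ominus> y' \<otimes> x \<otimes> y = x \<otimes> y"
    using arg_cong[OF y'(2), of "\<lambda>v. v \<otimes> y"] xc y(1) y'(1) by (simp add: diff_mult m_closed)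
  ultimately have "y' \<otimes> x = x \<otimes> y" by simp
  moreover have "y = x \<oplus> x \<otimes> y"
    using arg_cong[OF xy, of "\<lambda>v. v \<oplus> x \<otimes> y"] xc y(1) by (simp add: rng_simps)
  ultimately show ?thesis using y'_eq by simp
qed

end

section \<open>Epimorphisms and subrings\<close>

text \<open>Serves three kinds of maps: automorphisms, the projection modulo the radical, and the
  restriction of that projection to invariants.\<close>

locale rng_epi = R?: rng R + S?: rng S
  for R :: "('a, 'b) ring_scheme" (structure) and S :: "('c, 'd) ring_scheme" (structure) +
  fixes h
  assumes surj: "h ` carrier R = carrier S"
    and hom_add: "\<lbrakk>x \<in> carrier R; y \<in> carrier R\<rbrakk> \<Longrightarrow> h (x \<oplus> y) = h x \<oplus>\<^bsub>S\<^esub> h y"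
    and hom_mult: "\<lbrakk>x \<in> carrier R; y \<in> carrier R\<rbrakk> \<Longrightarrow> h (x \<otimes> y) = h x \<otimes>\<^bsub>S\<^esub> h y"
begin

lemma hom_closed: "x \<in> carrier R \<Longrightarrow> h x \<in> carrier S"
  using surj by auto

lemma hom_zero: "h \<zero> = \<zero>\<^bsub>S\<^esub>"
proof -
  have "h \<zero> \<oplus>\<^bsub>S\<^esub> h \<zero> = h \<zero> \<oplus>\<^bsub>S\<^esub> \<zero>\<^bsub>S\<^esub>"
    using hom_add[of \<zero> \<zero>] by (simp add: hom_closed)
  then show ?thesis by (simp add: hom_closed)
qed

lemma hom_diff: assumes "x \<in> carrier R" "y \<in> carrier R"
  shows "h (x \<ominus> y) = h x \<ominus>\<^bsub>S\<^esub> h y"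
proof -
  have "h (\<ominus> y) \<oplus>\<^bsub>S\<^esub> h y = \<zero>\<^bsub>S\<^esub>"
    using hom_add[of "\<ominus> y" y] assms by (simp add: R.l_neg hom_zero)
  then have "h (\<ominus> y) = \<ominus>\<^bsub>S\<^esub> h y"
    using assms by (metis S.minus_equality hom_closed R.a_inv_closed)
  then show ?thesis using assms by (simp add: a_minus_def hom_add)
qed

lemma hom_add_pow: "x \<in> carrier R \<Longrightarrow> h ([(n::nat)] \<cdot> x) = [n] \<cdot>\<^bsub>S\<^esub> h x"
  by (induction n) (simp_all add: hom_zero hom_add)

lemma left_ideal_vimage:
  assumes J: "left_ideal J S" shows "left_ideal {x \<in> carrier R. h x \<in> J} R"
  by (rule R.left_idealI)
    (auto simp: hom_zero hom_diff hom_mult R.m_closed hom_closed S.left_idealD[OF J])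

lemma left_ideal_image:
  assumes J: "left_ideal J R" shows "left_ideal (h ` J) S"
proof (rule S.left_idealI)
  have sub: "J \<subseteq> carrier R" by (rule R.left_ideal_subset[OF J])
  then show "h ` J \<subseteq> carrier S" using hom_closed by auto
  show "\<zero>\<^bsub>S\<^esub> \<in> h ` J" using R.left_ideal_zero[OF J] hom_zero by force
  fix r x assume "x \<in> h ` J"
  then obtain a where a: "a \<in> J" "x = h a" by blast
  { fix y assume "y \<in> h ` J"
    then obtain b where b: "b \<in> J" "y = h b" by blast
    then have "x \<ominus>\<^bsub>S\<^esub> y = h (a \<ominus> b)" using a sub hom_diff by (simp add: subset_iff)
    then show "x \<ominus>\<^bsub>S\<^esub> y \<in> h ` J" using R.left_ideal_diff[OF J a(1) b(1)] by blast }
  { assume "r \<in> carrier S"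
    then obtain s where s: "s \<in> carrier R" "r = h s" using surj by blast
    then have "r \<otimes>\<^bsub>S\<^esub> x = h (s \<otimes> a)" using a sub hom_mult by (simp add: subset_iff)
    then show "r \<otimes>\<^bsub>S\<^esub> x \<in> h ` J" using R.left_ideal_mult[OF J s(1) a(1)] by blast }
qed

text \<open>A left ideal containing the kernel is a union of fibres, since elements with equal
  images differ by an element of the kernel.\<close>

lemma image_mem_iff:
  assumes "left_ideal J R" "{x \<in> carrier R. h x = \<zero>\<^bsub>S\<^esub>} \<subseteq> J" "x \<in> carrier R"
  shows "h x \<in> h ` J \<longleftrightarrow> x \<in> J"
proof
  assume "h x \<in> h ` J"
  then obtain y where y: "y \<in> J" "h x = h y" by blast
  moreover have yc: "y \<in> carrier R" using y R.left_ideal_subset[OF assms(1)] by blast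
  ultimately have "h (x \<ominus> y) = h x \<ominus>\<^bsub>S\<^esub> h x" using assms(3) by (simp add: hom_diff)
  then have "h (x \<ominus> y) = \<zero>\<^bsub>S\<^esub>" using hom_closed[OF assms(3)] by (simp add: a_minus_def S.r_neg)
  then have "x \<ominus> y \<in> J" using assms yc by auto
  then show "x \<in> J" using R.left_ideal_diff_cancel[OF assms(1,3) y(1)] by blast
qed auto

text \<open>Half of the correspondence theorem. Any lift of a modular unit is a modular unit for the
  preimage, and a left ideal above the preimage is determined by its image.\<close>

lemma max_modular_vimage:
  assumes M: "S.max_modular M" shows "R.max_modular {x \<in> carrier R. h x \<in> M}" (is "R.max_modular ?N")
proof -
  note L = S.max_modular_left_ideal[OF M]
  obtain e' where e': "e' \<in> carrier S" "\<And>x. x \<in> carrier S \<Longrightarrow> x \<ominus>\<^bsub>S\<^esub> x \<otimes>\<^bsub>S\<^esub> e' \<in> M"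
    using S.max_modular_unit[OF M] by blast
  obtain e where e: "e \<in> carrier R" "e' = h e" using e'(1) surj by blast
  show ?thesis
  proof (rule R.max_modularI[OF left_ideal_vimage[OF L] _ _ e(1)])
    show "?N \<noteq> carrier R"
      using S.max_modular_unit_notin[OF M e'] e by auto
    show "x \<ominus> x \<otimes> e \<in> ?N" if "x \<in> carrier R" for x
      using that e e'(2)[OF hom_closed[OF that]] by (simp add: hom_diff hom_mult R.m_closed)
    show "carrier R \<subseteq> J" if J: "left_ideal J R" "?N \<subseteq> J" "J \<noteq> ?N" for J
    proof -
      have MJ: "M \<subseteq> h ` J"
      proof
        fix m assume m: "m \<in> M"
        then have "m \<in> h ` carrier R" using S.left_ideal_subset[OF L] surj by blast
        then show "m \<in> h ` J" using m J(2) by auto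
      qed
      have "{x \<in> carrier R. h x = \<zero>\<^bsub>S\<^esub>} \<subseteq> J" using J(2) S.left_ideal_zero[OF L] by auto
      note mem = image_mem_iff[OF J(1) this]
      have "h ` J \<noteq> M" using J(3) mem R.left_ideal_subset[OF J(1)] by auto
      then have "h ` J = carrier S"
        using S.max_modular_maximal[OF M left_ideal_image[OF J(1)] MJ] by blast
      then show "carrier R \<subseteq> J" using mem hom_closed by blast
    qed
  qed
qed

text \<open>The other half: the kernel condition keeps the image proper, and maximality is tested on
  preimages.\<close>

lemma max_modular_image:
  assumes M: "R.max_modular M" and ker: "{x \<in> carrier R. h x = \<zero>\<^bsub>S\<^esub>} \<subseteq> M"
  shows "S.max_modular (h ` M)"
proof -
  note L = R.max_modular_left_ideal[OF M]
  note mem = image_mem_iff[OF L ker]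
  obtain e where e: "e \<in> carrier R" "\<And>x. x \<in> carrier R \<Longrightarrow> x \<ominus> x \<otimes> e \<in> M"
    using R.max_modular_unit[OF M] by blast
  show ?thesis
  proof (rule S.max_modularI[OF left_ideal_image[OF L] _ _ hom_closed[OF e(1)]])
    show "h ` M \<noteq> carrier S"
      using mem[OF e(1)] R.max_modular_unit_notin[OF M e] hom_closed[OF e(1)] by auto
    show "x \<ominus>\<^bsub>S\<^esub> x \<otimes>\<^bsub>S\<^esub> h e \<in> h ` M" if x: "x \<in> carrier S" for x
    proof -
      obtain y where y: "y \<in> carrier R" "x = h y" using x surj by blast
      then have "x \<ominus>\<^bsub>S\<^esub> x \<otimes>\<^bsub>S\<^esub> h e = h (y \<ominus> y \<otimes> e)"
        using e(1) by (simp add: hom_diff hom_mult R.m_closed)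
      then show ?thesis using e(2)[OF y(1)] by simp
    qed
    show "carrier S \<subseteq> J" if J: "left_ideal J S" "h ` M \<subseteq> J" "J \<noteq> h ` M" for J
    proof -
      have "M \<subseteq> {x \<in> carrier R. h x \<in> J}" using J(2) R.left_ideal_subset[OF L] by auto
      then consider "{x \<in> carrier R. h x \<in> J} = M" | "{x \<in> carrier R. h x \<in> J} = carrier R"
        using R.max_modular_maximal[OF M left_ideal_vimage[OF J(1)]] by blast
      then show ?thesis
      proof cases
        case 1
        have "J \<subseteq> h ` M"
        proof
          fix y assume y: "y \<in> J"
          then obtain x where "x \<in> carrier R" "y = h x" using S.left_ideal_subset[OF J(1)] surj by blast
          then show "y \<in> h ` M" using 1 y by auto
        qed
        then show ?thesis using J by blast
      next
        case 2
        then have "h ` carrier R \<subseteq> J" by blast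
        then show ?thesis using surj by simp
      qed
    qed
  qed
qed

lemma jacobson_radical_image: "x \<in> jacobson_radical R \<Longrightarrow> h x \<in> jacobson_radical S"
  using max_modular_vimage by (fastforce simp: R.jacobson_radical_iff S.jacobson_radical_iff hom_closed)

text \<open>The kernel lies in every maximal modular left ideal of \<open>R\<close>, so each of
  these is the full preimage of one of \<open>S\<close>.\<close>

lemma jacobson_radical_reflect:
  assumes ker: "{x \<in> carrier R. h x = \<zero>\<^bsub>S\<^esub>} \<subseteq> jacobson_radical R"
    and x: "x \<in> carrier R" "h x \<in> jacobson_radical S"
  shows "x \<in> jacobson_radical R"
proof -
  have "x \<in> M" if M: "R.max_modular M" for M
  proof -
    have k: "{x \<in> carrier R. h x = \<zero>\<^bsub>S\<^esub>} \<subseteq> M" using ker M by (auto simp: R.jacobson_radical_iff)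
    have "h x \<in> h ` M" using x(2) max_modular_image[OF M k] by (simp add: S.jacobson_radical_iff)
    then show ?thesis using image_mem_iff[OF R.max_modular_left_ideal[OF M] k x(1)] by blast
  qed
  then show ?thesis using x(1) by (simp add: R.jacobson_radical_iff)
qed

end

lemma (in rng) rng_auto_epi:
  assumes "g \<in> rng_auto R" shows "rng_epi R R g"
proof -
  have "bij_betw g (carrier R) (carrier R)" using assms by (auto simp: rng_auto_def Bij_def)
  then have "g ` carrier R = carrier R" by (simp add: bij_betw_def)
  then show ?thesis using assms
    by (intro rng_epi.intro rng_axioms rng_epi_axioms.intro) (auto simp: rng_auto_def)
qed

section \<open>Subrings and rings of invariants\<close>

context rng
begin

text \<open>The second claim is a fact about inverses: those of the restricted record are sought
  inside \<open>A\<close>, and uniqueness identifies them with the inverses in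
  \<open>R\<close>.\<close>

lemma subrng:
  assumes A: "A \<subseteq> carrier R" "\<zero> \<in> A"
    and diff: "\<And>x y. \<lbrakk>x \<in> A; y \<in> A\<rbrakk> \<Longrightarrow> x \<ominus> y \<in> A"
    and mult: "\<And>x y. \<lbrakk>x \<in> A; y \<in> A\<rbrakk> \<Longrightarrow> x \<otimes> y \<in> A"
  shows "rng (R\<lparr>carrier := A\<rparr>)"
    and "\<lbrakk>x \<in> A; y \<in> A\<rbrakk> \<Longrightarrow> x \<ominus>\<^bsub>R\<lparr>carrier := A\<rparr>\<^esub> y = x \<ominus> y"
proof -
  have inv: "\<ominus> x \<in> A" if "x \<in> A" for x
    using diff[OF A(2) that] A(1) that by (auto simp: a_minus_def)
  have add: "x \<oplus> y \<in> A" if "x \<in> A" "y \<in> A" for x y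
    using diff[OF that(1) inv[OF that(2)]] A(1) that by (auto simp: a_minus_def)
  interpret A: abelian_group "R\<lparr>carrier := A\<rparr>"
  proof (rule abelian_groupI)
    fix x assume x: "x \<in> carrier (R\<lparr>carrier := A\<rparr>)"
    then show "\<exists>y\<in>carrier (R\<lparr>carrier := A\<rparr>).
        y \<oplus>\<^bsub>R\<lparr>carrier := A\<rparr>\<^esub> x = \<zero>\<^bsub>R\<lparr>carrier := A\<rparr>\<^esub>"
      using inv A(1) by (auto intro!: bexI[of _ "\<ominus> x"] simp: l_neg)
  qed (use A add in \<open>auto simp: a_ac subset_iff\<close>)
  show "rng (R\<lparr>carrier := A\<rparr>)"
    by unfold_locales
      (use A(1) mult in \<open>auto simp: m_assoc l_distr r_distr subset_iff\<close>)
  assume xy: "x \<in> A" "y \<in> A"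
  then have "\<ominus>\<^bsub>R\<lparr>carrier := A\<rparr>\<^esub> y = \<ominus> y"
    using A.minus_equality[of "\<ominus> y" y] inv A(1) by (auto simp: l_neg)
  then show "x \<ominus>\<^bsub>R\<lparr>carrier := A\<rparr>\<^esub> y = x \<ominus> y" by (simp add: a_minus_def)
qed

lemma invariants_closed:
  assumes "H \<subseteq> rng_auto R"
  shows "invariants R H \<subseteq> carrier R" "\<zero> \<in> invariants R H"
    and "\<And>x y. \<lbrakk>x \<in> invariants R H; y \<in> invariants R H\<rbrakk> \<Longrightarrow> x \<ominus> y \<in> invariants R H"
    and "\<And>x y. \<lbrakk>x \<in> invariants R H; y \<in> invariants R H\<rbrakk> \<Longrightarrow> x \<otimes> y \<in> invariants R H"
proof -
  have epi: "rng_epi R R g" if "g \<in> H" for g using rng_auto_epi that assms by blast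
  show "invariants R H \<subseteq> carrier R" "\<zero> \<in> invariants R H"
    using rng_epi.hom_zero[OF epi] by (auto simp: invariants_def)
  fix x y assume xy: "x \<in> invariants R H" "y \<in> invariants R H"
  have "g (x \<ominus> y) = x \<ominus> y" "g (x \<otimes> y) = x \<otimes> y" if "g \<in> H" for g
  proof -
    have "g x = x" "g y = y" "x \<in> carrier R" "y \<in> carrier R" using xy that by (auto simp: invariants_def)
    then show "g (x \<ominus> y) = x \<ominus> y" "g (x \<otimes> y) = x \<otimes> y"
      using rng_epi.hom_diff[OF epi[OF that], of x y] rng_epi.hom_mult[OF epi[OF that], of x y]
      by simp_all
  qed
  then show "x \<ominus> y \<in> invariants R H" "x \<otimes> y \<in> invariants R H"
    using xy by (auto simp: invariants_def m_closed)
qed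

lemma invariant_ring:
  assumes "H \<subseteq> rng_auto R"
  shows "rng (invariant_ring R H)"
    and "\<lbrakk>x \<in> invariants R H; y \<in> invariants R H\<rbrakk> \<Longrightarrow> x \<ominus>\<^bsub>invariant_ring R H\<^esub> y = x \<ominus> y"
  unfolding invariant_ring_def by (intro subrng invariants_closed[OF assms]; assumption)+

lemma invariant_ring_simps:
  "carrier (invariant_ring R H) = invariants R H"
  "x \<oplus>\<^bsub>invariant_ring R H\<^esub> y = x \<oplus> y"
  "x \<otimes>\<^bsub>invariant_ring R H\<^esub> y = x \<otimes> y"
  "\<zero>\<^bsub>invariant_ring R H\<^esub> = \<zero>"
  "[(n::nat)] \<cdot>\<^bsub>invariant_ring R H\<^esub> x = [n] \<cdot> x"
  by (simp_all add: invariant_ring_def add_pow_def nat_pow_def)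

text \<open>Were \<open>x\<close> outside \<open>M\<close>, some \<open>t x\<close> would be
  congruent to the modular unit \<open>e\<close>. The quasi-inverse \<open>y\<close> of
  \<open>t x\<close> in \<open>R\<close> is invariant, so \<open>(1 + y) (1 - t x) = 1\<close> is
  available in the invariant ring and forces \<open>e\<close> into \<open>M\<close>.\<close>

lemma jacobson_radical_inter_invariants:
  assumes H: "H \<subseteq> rng_auto R"
  shows "jacobson_radical R \<inter> invariants R H \<subseteq> jacobson_radical (invariant_ring R H)"
proof
  fix x assume x: "x \<in> jacobson_radical R \<inter> invariants R H"
  interpret T: rng "invariant_ring R H" by (rule invariant_ring(1)[OF H])
  note Tsimps = invariant_ring_simps invariant_ring(2)[OF H]
  note sub = subsetD[OF invariants_closed(1)[OF H]]
  have "x \<in> M" if M: "T.max_modular M" for M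
  proof (rule ccontr)
    assume xM: "x \<notin> M"
    note L = T.max_modular_left_ideal[OF M]
    obtain e where e: "e \<in> invariants R H"
        "\<And>y. y \<in> invariants R H \<Longrightarrow> y \<ominus>\<^bsub>invariant_ring R H\<^esub> y \<otimes> e \<in> M"
      using T.max_modular_unit[OF M] by (auto simp: Tsimps)
    obtain t where t: "t \<in> invariants R H" "e \<ominus>\<^bsub>invariant_ring R H\<^esub> t \<otimes> x \<in> M"
      using T.max_modular_simple[OF M _ xM, of e] x e(1) by (auto simp: Tsimps)
    have q: "t \<otimes> x \<in> invariants R H" "t \<otimes> x \<in> jacobson_radical R"
      using x t(1) sub invariants_closed(4)[OF H] left_ideal_mult[OF jacobson_radical_left_ideal]
      by auto
    obtain y where y: "y \<in> carrier R" "y \<ominus> y \<otimes> (t \<otimes> x) = t \<otimes> x"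
      using jacobson_radical_quasi_regular[OF q(2)] by blast
    \<comment> \<open>Both \<open>h y\<close> and \<open>y\<close> are quasi-inverses of
      \<open>t x\<close>, which \<open>h\<close> fixes.\<close>
    have "h y = y" if "h \<in> H" for h
    proof (rule jacobson_radical_quasi_inverse_unique[OF q(2) _ _ y])
      interpret h: rng_epi R R h using rng_auto_epi H that by blast
      show "h y \<in> carrier R" using y(1) by (rule h.hom_closed)
      have "h (t \<otimes> x) = t \<otimes> x" using q(1) that by (simp add: invariants_def)
      then show "h y \<ominus> h y \<otimes> (t \<otimes> x) = t \<otimes> x"
        using arg_cong[OF y(2), of h] y(1) sub[OF q(1)]
        by (simp add: h.hom_diff h.hom_mult m_closed)
    qed
    then have yT: "y \<in> invariants R H" using y(1) by (simp add: invariants_def)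
    let ?d = "e \<ominus> t \<otimes> x"
    have d: "?d \<in> M" using t(2) e(1) q(1) by (simp add: Tsimps)
    have "y \<otimes> ?d \<in> M" using T.left_ideal_mult[OF L _ d] yT by (simp add: Tsimps)
    then have "?d \<oplus> y \<otimes> ?d \<in> M" using T.left_ideal_add[OF L d] by (simp add: Tsimps)
    \<comment> \<open>Formally the left side is \<open>(1 + y) (e - t x)\<close>; as
      \<open>t x + y (t x) = y\<close>, it is \<open>e\<close> minus \<open>y - y e\<close>, and the
      latter lies in \<open>M\<close>.\<close>
    moreover have "?d \<oplus> y \<otimes> ?d = e \<ominus> (y \<ominus> y \<otimes> e)"
    proof -
      have "?d \<oplus> y \<otimes> ?d = e \<ominus> (t \<otimes> x) \<oplus> y \<otimes> e \<ominus> y \<otimes> (t \<otimes> x)"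
        using sub[OF e(1)] sub[OF q(1)] y(1) by (simp add: rng_simps)
      also have "\<dots> = e \<oplus> y \<otimes> e \<ominus> (t \<otimes> x \<oplus> y \<otimes> (t \<otimes> x))"
        using sub[OF e(1)] sub[OF q(1)] y(1) by (simp add: rng_simps)
      also have "t \<otimes> x \<oplus> y \<otimes> (t \<otimes> x) = y"
        using arg_cong[OF y(2), of "\<lambda>u. u \<oplus> y \<otimes> (t \<otimes> x)"] sub[OF q(1)] y(1) by (simp add: rng_simps)
      finally show ?thesis
        using sub[OF e(1)] y(1) by (simp add: rng_simps)
    qed
    ultimately have "e \<ominus>\<^bsub>invariant_ring R H\<^esub> (y \<ominus>\<^bsub>invariant_ring R H\<^esub> y \<otimes> e) \<in> M"
      using e(1) yT invariants_closed[OF H] by (simp add: Tsimps)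
    then have "e \<in> M"
      using T.left_ideal_diff_cancel[OF L _ e(2)[OF yT], of e] e(1) by (simp add: Tsimps)
    then show False using T.max_modular_unit_notin[OF M, of e] e by (simp add: Tsimps)
  qed
  then show "x \<in> jacobson_radical (invariant_ring R H)"
    using x by (simp add: T.jacobson_radical_iff Tsimps)
qed

text \<open>Composition with \<open>g\<close> maps the finite set \<open>H\<close> injectively into
  itself, hence permutes the summands. Members of \<open>H\<close> are extensional, so agreement on
  the carrier makes them equal.\<close>

lemma orbit_sum_invariant:
  assumes H: "H \<subseteq> rng_auto R" "finite H"
    and comp: "\<And>g h. \<lbrakk>g \<in> H; h \<in> H\<rbrakk> \<Longrightarrow> compose (carrier R) g h \<in> H"
    and s: "s \<in> carrier R"
  shows "(\<Oplus>h\<in>H. h s) \<in> invariants R H"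
proof -
  have epi: "rng_epi R R g" if "g \<in> H" for g using rng_auto_epi that H(1) by blast
  have cl: "h x \<in> carrier R" if "h \<in> H" "x \<in> carrier R" for h x
    by (rule rng_epi.hom_closed[OF epi[OF that(1)] that(2)])
  have "g (\<Oplus>h\<in>H. h s) = (\<Oplus>h\<in>H. h s)" if g: "g \<in> H" for g
  proof -
    interpret g: rng_epi R R g by (rule epi[OF g])
    have inj: "inj_on (compose (carrier R) g) H"
    proof (rule inj_onI)
      fix h k assume hk: "h \<in> H" "k \<in> H" "compose (carrier R) g h = compose (carrier R) g k"
      have "h \<in> extensional (carrier R)" "k \<in> extensional (carrier R)"
        using hk H(1) by (auto simp: rng_auto_def Bij_def)
      moreover have "h x = k x" if x: "x \<in> carrier R" for x
      proof -
        have "g (h x) = g (k x)" using fun_cong[OF hk(3), of x] x by (simp add: compose_def)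
        moreover have "inj_on g (carrier R)"
          using g H(1) by (auto simp: rng_auto_def Bij_def bij_betw_def)
        ultimately show ?thesis using cl hk x by (auto dest: inj_onD)
      qed
      ultimately show "h = k" by (rule extensionalityI)
    qed
    have "g (\<Oplus>h\<in>E. h s) = (\<Oplus>h\<in>E. compose (carrier R) g h s)" if "finite E" "E \<subseteq> H" for E
      using that
    proof (induction E)
      case empty
      show ?case by (simp add: g.hom_zero)
    next
      case (insert k E)
      have c: "(\<Oplus>h\<in>E. h s) \<in> carrier R" using insert.prems cl s by (auto intro!: finsum_closed)
      have "compose (carrier R) g h s \<in> carrier R" if "h \<in> insert k E" for h
        using that insert.prems cl s g by (auto simp: compose_def)
      then have "(\<Oplus>h\<in>insert k E. compose (carrier R) g h s) =
          g (k s) \<oplus> (\<Oplus>h\<in>E. compose (carrier R) g h s)"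
        using insert.hyps s by (subst finsum_insert) (auto simp: compose_def)
      moreover have "(\<Oplus>h\<in>insert k E. h s) = k s \<oplus> (\<Oplus>h\<in>E. h s)"
        using insert cl s by (subst finsum_insert) auto
      ultimately show ?case using insert c cl s by (simp add: g.hom_add)
    qed
    then have "g (\<Oplus>h\<in>H. h s) = (\<Oplus>h\<in>H. compose (carrier R) g h s)" using H(2) by blast
    also have "\<dots> = (\<Oplus>k\<in>(\<lambda>h. compose (carrier R) g h) ` H. k s)"
    proof (rule finsum_reindex[symmetric])
      show "(\<lambda>k. k s) \<in> compose (carrier R) g ` H \<rightarrow> carrier R" using comp[OF g] cl s by auto
      show "inj_on (compose (carrier R) g) H" by (rule inj)
    qed
    also have "(\<lambda>h. compose (carrier R) g h) ` H = H"
    proof (rule endo_inj_surj[OF H(2)])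
      show "compose (carrier R) g ` H \<subseteq> H" using comp[OF g] by blast
      show "inj_on (compose (carrier R) g) H" by (rule inj)
    qed
    finally show ?thesis .
  qed
  moreover have "(\<Oplus>h\<in>H. h s) \<in> carrier R" using cl s by (auto intro!: finsum_closed)
  ultimately show ?thesis by (simp add: invariants_def)
qed

section \<open>The radical of the invariants\<close>

text \<open>
  The family of the \<open>h s z\<close>, \<open>h \<in> H\<close>, runs through a submodule \<open>X\<close> of the direct sum of the twists
  of the simple module \<open>R / M\<close>.  The set \<open>D\<close> is a maximal set of coordinates such that no nonzero
  element of \<open>X\<close> is supported on \<open>D\<close>, so that \<open>X\<close> and the coordinates in \<open>D\<close> span.
\<close>

lemma simple_twists_complement:
  assumes H: "H \<subseteq> rng_auto R" "finite H" and M: "max_modular M"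
    and z: "z \<in> carrier R"
  shows "\<exists>D\<subseteq>H.
    (\<forall>s\<in>carrier R. (\<forall>k\<in>H - D. k s \<otimes> z \<in> M) \<longrightarrow> (\<forall>h\<in>H. h s \<otimes> z \<in> M)) \<and>
    (\<forall>w\<in>carrier R. \<exists>s\<in>carrier R. \<forall>h\<in>H - D. w \<ominus> h s \<otimes> z \<in> M)"
proof -
  note L = max_modular_left_ideal[OF M]
  have epi: "rng_epi R R g" if "g \<in> H" for g using rng_auto_epi that H(1) by blast
  have cl: "h x \<in> carrier R" if "h \<in> H" "x \<in> carrier R" for h x
    by (rule rng_epi.hom_closed[OF epi[OF that(1)] that(2)])
  define P where "P D \<longleftrightarrow> D \<subseteq> H \<and> (\<forall>s\<in>carrier R. (\<forall>k\<in>H - D. k s \<otimes> z \<in> M) \<longrightarrow>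
      (\<forall>h\<in>H. h s \<otimes> z \<in> M))" for D
  have "P {}" by (simp add: P_def)
  moreover have "finite (Collect P)" using H(2) by (rule_tac finite_subset[of _ "Pow H"]) (auto simp: P_def)
  ultimately obtain D where D: "P D" "\<And>E. P E \<Longrightarrow> D \<subseteq> E \<Longrightarrow> E = D"
    using finite_has_maximal[of "Collect P"] by auto
  \<comment> \<open>By maximality of \<open>D\<close>, some nonzero element of \<open>X\<close> is
    supported on \<open>insert h D\<close>; its coordinate at \<open>h\<close> cannot vanish, or it
    would be supported on \<open>D\<close>.\<close>
  have "\<exists>u\<in>carrier R. h u \<otimes> z \<notin> M \<and> (\<forall>k\<in>H - insert h D. k u \<otimes> z \<in> M)" if h: "h \<in> H - D" for h
  proof -
    have "\<not> P (insert h D)" using D(2)[of "insert h D"] h by auto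
    then obtain u where u: "u \<in> carrier R" "\<forall>k\<in>H - insert h D. k u \<otimes> z \<in> M"
        "\<not> (\<forall>k\<in>H. k u \<otimes> z \<in> M)"
      using h D(1) unfolding P_def by blast
    then have "\<not> (\<forall>k\<in>H - D. k u \<otimes> z \<in> M)" using D(1) unfolding P_def by blast
    then show ?thesis using u by blast
  qed
  then obtain u where u: "\<And>h. h \<in> H - D \<Longrightarrow> u h \<in> carrier R"
      "\<And>h. h \<in> H - D \<Longrightarrow> h (u h) \<otimes> z \<notin> M"
      "\<And>h k. h \<in> H - D \<Longrightarrow> k \<in> H - insert h D \<Longrightarrow> k (u h) \<otimes> z \<in> M"
    by metis
  \<comment> \<open>Prescribes the coordinates outside \<open>D\<close> one at a time:
    \<open>w\<close> on \<open>E\<close>, zero on the rest. Correcting with a multiple of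
    \<open>u g\<close> is harmless, as among the coordinates outside \<open>D\<close> only the one
    at \<open>g\<close> changes modulo \<open>M\<close>.\<close>
  have "\<exists>s\<in>carrier R. (\<forall>h\<in>E. w \<ominus> h s \<otimes> z \<in> M) \<and> (\<forall>h\<in>H - D - E. h s \<otimes> z \<in> M)"
    if w: "w \<in> carrier R" and "finite E" "E \<subseteq> H - D" for w E
    using that(2,3)
  proof (induction E)
    case empty
    have "h \<zero> \<otimes> z \<in> M" if "h \<in> H" for h
      unfolding rng_epi.hom_zero[OF epi[OF that]] using z left_ideal_zero[OF L] by (simp add: l_null)
    then show ?case by (intro bexI[of _ \<zero>]) auto
  next
    case (insert g E)
    then obtain s where s: "s \<in> carrier R" "\<And>h. h \<in> E \<Longrightarrow> w \<ominus> h s \<otimes> z \<in> M"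
        "\<And>h. h \<in> H - D - E \<Longrightarrow> h s \<otimes> z \<in> M"
      by blast
    have g: "g \<in> H" "g \<in> H - D" using insert.prems by auto
    interpret g: rng_epi R R g by (rule epi[OF g(1)])
    obtain r where r: "r \<in> carrier R" "w \<ominus> r \<otimes> (g (u g) \<otimes> z) \<in> M"
      using max_modular_simple[OF M m_closed[OF cl[OF g(1) u(1)[OF g(2)]] z] u(2)[OF g(2)] w] by blast
    \<comment> \<open>The ring acts on the coordinate at \<open>g\<close> through \<open>g\<close>,
      so the multiplier \<open>r\<close> needed there comes from a \<open>q\<close> with
      \<open>g q = r\<close>.\<close>
    have "r \<in> g ` carrier R" using r(1) g.surj by simp
    then obtain q where q: "q \<in> carrier R" "g q = r" by blast
    have qu: "q \<otimes> u g \<in> carrier R" using q u(1)[OF g(2)] by (simp add: m_closed)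
    have expand: "h (s \<oplus> q \<otimes> u g) \<otimes> z = h s \<otimes> z \<oplus> h q \<otimes> (h (u g) \<otimes> z)" if "h \<in> H" for h
      using that s(1) q(1) qu u(1)[OF g(2)] z cl[OF that]
      by (simp add: rng_epi.hom_add[OF epi] rng_epi.hom_mult[OF epi] l_distr m_assoc m_closed)
    have off: "h q \<otimes> (h (u g) \<otimes> z) \<in> M" if "h \<in> H - D" "h \<noteq> g" for h
    proof (rule left_ideal_mult[OF L cl[OF _ q(1)]])
      show "h \<in> H" using that by blast
      show "h (u g) \<otimes> z \<in> M" using u(3)[OF g(2), of h] that by blast
    qed
    have sz: "h s \<otimes> z \<in> carrier R" if "h \<in> H" for h
      by (rule m_closed[OF cl[OF that s(1)] z])
    show ?case
    proof (intro bexI conjI ballI)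
      show "s \<oplus> q \<otimes> u g \<in> carrier R" using s(1) qu by simp
      show "h (s \<oplus> q \<otimes> u g) \<otimes> z \<in> M" if "h \<in> H - D - insert g E" for h
        using that s(3)[of h] off[of h] left_ideal_add[OF L] by (auto simp: expand)
      show "w \<ominus> h (s \<oplus> q \<otimes> u g) \<otimes> z \<in> M" if h: "h \<in> insert g E" for h
      proof (cases "h = g")
        case True
        have "g s \<otimes> z \<in> M" using s(3)[of g] g(2) insert.hyps(2) by blast
        moreover have "w \<ominus> (g s \<otimes> z \<oplus> r \<otimes> (g (u g) \<otimes> z)) =
            (w \<ominus> r \<otimes> (g (u g) \<otimes> z)) \<ominus> g s \<otimes> z"
          using w r(1) sz[OF g(1)] cl[OF g(1) u(1)[OF g(2)]] z by (simp add: rng_simps)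
        ultimately show ?thesis
          using r(2) left_ideal_diff[OF L] by (simp add: True expand[OF g(1)] q(2))
      next
        case False
        then have hE: "h \<in> E" "h \<in> H - D" "h \<in> H" using h insert.prems by auto
        have "w \<ominus> (h s \<otimes> z \<oplus> h q \<otimes> (h (u g) \<otimes> z)) =
            (w \<ominus> h s \<otimes> z) \<ominus> h q \<otimes> (h (u g) \<otimes> z)"
          using w sz[OF hE(3)] cl[OF hE(3) u(1)[OF g(2)]] cl[OF hE(3) q(1)] z by (simp add: rng_simps)
        then show ?thesis
          using s(2)[OF hE(1)] off[OF hE(2) False] left_ideal_diff[OF L] by (simp add: expand[OF hE(3)])
      qed
    qed
  qed
  then have "\<exists>s\<in>carrier R. \<forall>h\<in>H - D. w \<ominus> h s \<otimes> z \<in> M" if "w \<in> carrier R" for w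
    using that H(2) by (meson finite_Diff order_refl)
  then show ?thesis using D(1) unfolding P_def by blast
qed

text \<open>
  If multiplication by \<open>|H|\<close> is not zero on \<open>R / M\<close> then it is bijective, and the complement above
  replaces the averaged complement of Maschke's theorem.
\<close>

theorem card_jacobson_radical_invariants:
  assumes H: "H \<subseteq> rng_auto R" "finite H"
    and comp: "\<And>g h. \<lbrakk>g \<in> H; h \<in> H\<rbrakk> \<Longrightarrow> compose (carrier R) g h \<in> H"
    and a: "a \<in> jacobson_radical (invariant_ring R H)"
  shows "[card H] \<cdot> a \<in> jacobson_radical R"
proof -
  interpret T: rng "invariant_ring R H" by (rule invariant_ring(1)[OF H(1)])
  note Tsimps = invariant_ring_simps invariant_ring(2)[OF H(1)]
  note sub = subsetD[OF invariants_closed(1)[OF H(1)]]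
  have epi: "rng_epi R R g" if "g \<in> H" for g using rng_auto_epi that H(1) by blast
  have cl: "h x \<in> carrier R" if "h \<in> H" "x \<in> carrier R" for h x
    by (rule rng_epi.hom_closed[OF epi[OF that(1)] that(2)])
  let ?n = "card H"
  have aT: "a \<in> invariants R H" using a by (simp add: T.jacobson_radical_iff Tsimps)
  have ac: "a \<in> carrier R" by (rule sub[OF aT])
  have "[?n] \<cdot> a \<in> M" if M: "max_modular M" for M
  proof -
    note L = max_modular_left_ideal[OF M]
    obtain e where e: "e \<in> carrier R" "\<And>x. x \<in> carrier R \<Longrightarrow> x \<ominus> x \<otimes> e \<in> M"
      using max_modular_unit[OF M] by blast
    show ?thesis
    proof (rule max_modular_torsion[OF M, of ?n])
      assume "\<And>x. x \<in> carrier R \<Longrightarrow> [?n] \<cdot> x \<in> M"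
      then show ?thesis using ac by blast
    next
      assume tf: "\<And>x. \<lbrakk>x \<in> carrier R; [?n] \<cdot> x \<in> M\<rbrakk> \<Longrightarrow> x \<in> M"
        and div: "\<And>w. w \<in> carrier R \<Longrightarrow> \<exists>v\<in>carrier R. w \<ominus> [?n] \<cdot> v \<in> M"
      \<comment> \<open>Modulo \<open>M\<close>, \<open>w\<close> stands for \<open>e\<close>
        divided by \<open>|H|\<close>. The \<open>z\<close> below is then congruent to
        \<open>a e\<close>, hence to \<open>a\<close>, and it suffices to place \<open>z\<close> in
        \<open>M\<close>.\<close>
      obtain w where w: "w \<in> carrier R" "e \<ominus> [?n] \<cdot> w \<in> M" using div[OF e(1)] by blast
      define z where "z = a \<otimes> [?n] \<cdot> w"
      have z: "z \<in> carrier R" using ac w(1) by (simp add: z_def m_closed)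
      obtain D where D:
          "\<forall>s\<in>carrier R. (\<forall>k\<in>H - D. k s \<otimes> z \<in> M) \<longrightarrow> (\<forall>h\<in>H. h s \<otimes> z \<in> M)"
          "\<forall>w\<in>carrier R. \<exists>s\<in>carrier R. \<forall>h\<in>H - D. w \<ominus> h s \<otimes> z \<in> M"
        using simple_twists_complement[OF H M z] by blast
      \<comment> \<open>The element of \<open>X\<close> given by \<open>s\<close> agrees with the
        constant vector \<open>w\<close> outside \<open>D\<close>: it is the projection of that
        vector to \<open>X\<close> along the coordinates in \<open>D\<close>.\<close>
      obtain s where s: "s \<in> carrier R" "\<And>h. h \<in> H - D \<Longrightarrow> w \<ominus> h s \<otimes> z \<in> M"
        using D(2) w(1) by blast
      \<comment> \<open>The congruence is tested after multiplication by an arbitrary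
        \<open>r = h p\<close>, because the differences are then the coordinates of an element of
        \<open>X\<close>, the one given by \<open>?y\<close>. Outside \<open>D\<close> they vanish,
        as \<open>z\<close> is \<open>|H| a w\<close>; by the choice of \<open>D\<close> they vanish
        everywhere.\<close>
      have z_eq: "z \<ominus> [?n] \<cdot> (a \<otimes> (h s \<otimes> z)) \<in> M" if h: "h \<in> H" for h
      proof (rule max_modular_annihilated[OF M])
        show "z \<ominus> [?n] \<cdot> (a \<otimes> (h s \<otimes> z)) \<in> carrier R"
          using z ac cl[OF h s(1)] by (simp add: m_closed)
        fix r assume "r \<in> carrier R"
        then obtain p where p: "p \<in> carrier R" "r = h p" using rng_epi.surj[OF epi[OF h]] by blast
        let ?y = "p \<ominus> [?n] \<cdot> (p \<otimes> (a \<otimes> s))"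
        have y: "?y \<in> carrier R" using p s ac by (simp add: m_closed)
        have y_eq: "k ?y \<otimes> z = k p \<otimes> (z \<ominus> [?n] \<cdot> (a \<otimes> (k s \<otimes> z)))" if k: "k \<in> H" for k
        proof -
          interpret k: rng_epi R R k by (rule epi[OF k])
          have "k a = a" using aT k by (simp add: invariants_def)
          then have "k ?y = k p \<ominus> [?n] \<cdot> (k p \<otimes> (a \<otimes> k s))"
            using p(1) s(1) ac by (simp add: k.hom_diff k.hom_add_pow k.hom_mult m_closed)
          then show ?thesis
            using k.hom_closed[OF p(1)] k.hom_closed[OF s(1)] ac z
            by (simp add: diff_mult mult_diff add_pow_mult mult_add_pow m_assoc m_closed)
        qed
        have "k ?y \<otimes> z \<in> M" if k: "k \<in> H - D" for k
        proof -
          have ks: "k s \<otimes> z \<in> carrier R" by (rule m_closed[OF cl[OF _ s(1)] z]) (use k in blast)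
          have "z \<ominus> [?n] \<cdot> (a \<otimes> (k s \<otimes> z)) = [?n] \<cdot> (a \<otimes> (w \<ominus> k s \<otimes> z))"
            using ks ac w(1) by (simp add: z_def[symmetric] mult_diff add_pow_diff m_closed)
              (simp add: z_def mult_add_pow)
          moreover have "[?n] \<cdot> (a \<otimes> (w \<ominus> k s \<otimes> z)) \<in> M"
            by (intro left_ideal_add_pow[OF L] left_ideal_mult[OF L] ac s(2) k)
          moreover have "k p \<in> carrier R" using cl p(1) k by blast
          ultimately show ?thesis using k left_ideal_mult[OF L] by (simp add: y_eq)
        qed
        then have "h ?y \<otimes> z \<in> M" using D(1) y h by blast
        then show "r \<otimes> (z \<ominus> [?n] \<cdot> (a \<otimes> (h s \<otimes> z))) \<in> M" by (simp add: y_eq[OF h] p(2))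
      qed
      define t where "t = (\<Oplus>h\<in>H. h s)"
      have tT: "t \<in> invariants R H" unfolding t_def by (rule orbit_sum_invariant[OF H comp s(1)])
      have tc: "t \<in> carrier R" by (rule sub[OF tT])
      \<comment> \<open>Partial sums of the congruences \<open>z_eq\<close>. For
        \<open>E = H\<close> both sides carry the factor \<open>|H|\<close>, which \<open>tf\<close>
        cancels, leaving \<open>z\<close> congruent to \<open>a t z\<close>.\<close>
      have "[card E] \<cdot> z \<ominus> [?n] \<cdot> (a \<otimes> ((\<Oplus>h\<in>E. h s) \<otimes> z)) \<in> M" if "finite E" "E \<subseteq> H" for E
        using that
      proof (induction E)
        case empty
        show ?case using ac z left_ideal_zero[OF L] by (simp add: l_null r_null a_minus_def minus_zero)
      next
        case (insert k E)
        let ?S = "\<Oplus>h\<in>E. h s"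
        have S: "?S \<in> carrier R" using insert.prems cl s(1) by (auto intro!: finsum_closed)
        have ks: "k s \<in> carrier R" using insert.prems cl s(1) by auto
        have sum: "(\<Oplus>h\<in>insert k E. h s) = k s \<oplus> ?S"
          using insert cl s(1) by (subst finsum_insert) auto
        have "[?n] \<cdot> (a \<otimes> ((k s \<oplus> ?S) \<otimes> z)) = [?n] \<cdot> (a \<otimes> (k s \<otimes> z)) \<oplus> [?n] \<cdot> (a \<otimes> (?S \<otimes> z))"
          using S ks ac z by (simp add: l_distr r_distr m_closed add.nat_pow_distrib)
        then have "[card (insert k E)] \<cdot> z \<ominus> [?n] \<cdot> (a \<otimes> ((\<Oplus>h\<in>insert k E. h s) \<otimes> z)) =
            ([card E] \<cdot> z \<ominus> [?n] \<cdot> (a \<otimes> (?S \<otimes> z))) \<oplus> (z \<ominus> [?n] \<cdot> (a \<otimes> (k s \<otimes> z)))"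
          using insert.hyps S ks ac z unfolding sum
          by (simp add: a_minus_def minus_add a_ac m_closed)
        then show ?case
          using left_ideal_add[OF L insert.IH z_eq] insert.prems by simp
      qed
      from this[OF H(2) order_refl] have "[?n] \<cdot> (z \<ominus> a \<otimes> (t \<otimes> z)) \<in> M"
        using z ac tc by (simp add: t_def[symmetric] add_pow_diff m_closed)
      then have zat: "z \<ominus> a \<otimes> (t \<otimes> z) \<in> M" using tf z ac tc by (simp add: m_closed)
      have "t \<otimes> a \<in> jacobson_radical (invariant_ring R H)"
        using T.left_ideal_mult[OF T.jacobson_radical_left_ideal _ a, of t] tT by (simp add: Tsimps)
      then obtain b where b: "b \<in> invariants R H" "b \<ominus>\<^bsub>invariant_ring R H\<^esub> b \<otimes> (t \<otimes> a) = t \<otimes> a"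
        using T.jacobson_radical_quasi_regular by (force simp: Tsimps)
      have bc: "b \<in> carrier R" by (rule sub[OF b(1)])
      have b_eq: "b \<ominus> b \<otimes> (t \<otimes> a) = t \<otimes> a"
        using b tT aT invariants_closed(4)[OF H(1)] by (simp add: Tsimps)
      \<comment> \<open>\<open>?d\<close> is formally \<open>(1 - t a) ?v\<close>, so multiplying by
        \<open>1 + b\<close> recovers \<open>?v\<close> and places it in \<open>M\<close>.\<close>
      let ?v = "t \<otimes> z" and ?d = "t \<otimes> z \<ominus> t \<otimes> a \<otimes> (t \<otimes> z)"
      have v: "?v \<in> carrier R" using tc z by (simp add: m_closed)
      have "?d = t \<otimes> (z \<ominus> a \<otimes> (t \<otimes> z))"
        using tc ac z by (simp add: mult_diff m_assoc m_closed)
      then have d: "?d \<in> M" using left_ideal_mult[OF L tc zat] by simp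
      have "?d \<oplus> b \<otimes> ?d = ?v \<ominus> t \<otimes> a \<otimes> ?v \<oplus> (b \<ominus> b \<otimes> (t \<otimes> a)) \<otimes> ?v"
        using v tc ac bc by (simp add: diff_mult mult_diff m_assoc m_closed)
      also have "\<dots> = ?v"
        unfolding b_eq using v tc ac by (simp add: rng_simps)
      finally have "?v \<in> M" using left_ideal_add[OF L d left_ideal_mult[OF L bc d]] by simp
      then have "z \<in> M" using left_ideal_diff_cancel[OF L z left_ideal_mult[OF L ac] zat] by blast
      moreover have "a \<otimes> e \<ominus> z \<in> M"
        using left_ideal_mult[OF L ac w(2)] ac e(1) w(1) by (simp add: z_def mult_diff)
      ultimately have "a \<otimes> e \<in> M"
        using left_ideal_diff_cancel[OF L m_closed[OF ac e(1)]] by blast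
      then have "a \<in> M" using left_ideal_diff_cancel[OF L ac _ e(2)[OF ac]] by blast
      then show ?thesis by (rule left_ideal_add_pow[OF L])
    qed
  qed
  then show ?thesis using ac by (simp add: jacobson_radical_iff)
qed

end

section \<open>The quotient by the radical and the induced automorphisms\<close>

lemma rng_epi_quotient:
  fixes R :: "('a, 'b) ring_scheme" and S :: "('c, 'd) ring_scheme"
  assumes "rng R" and surj: "h ` carrier R = carrier S" and zero: "h \<zero>\<^bsub>R\<^esub> = \<zero>\<^bsub>S\<^esub>"
    and add: "\<And>x y. \<lbrakk>x \<in> carrier R; y \<in> carrier R\<rbrakk> \<Longrightarrow> h (x \<oplus>\<^bsub>R\<^esub> y) = h x \<oplus>\<^bsub>S\<^esub> h y"
    and mult: "\<And>x y. \<lbrakk>x \<in> carrier R; y \<in> carrier R\<rbrakk> \<Longrightarrow> h (x \<otimes>\<^bsub>R\<^esub> y) = h x \<otimes>\<^bsub>S\<^esub> h y"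
  shows "rng_epi R S h"
proof -
  interpret R: rng R by fact
  \<comment> \<open>The axioms of \<open>S\<close> are inherited through \<open>h\<close>, because
    every element of \<open>S\<close> is an image.\<close>
  have S_eq: "carrier S = h ` carrier R" using surj by simp
  interpret S: abelian_group S
  proof (rule abelian_groupI)
    fix x assume "x \<in> carrier S"
    then obtain y where "y \<in> carrier R" "x = h y" using S_eq by blast
    then show "\<exists>y\<in>carrier S. y \<oplus>\<^bsub>S\<^esub> x = \<zero>\<^bsub>S\<^esub>"
      unfolding S_eq
      by (intro bexI[of _ "h (\<ominus>\<^bsub>R\<^esub> y)"]) (simp_all add: add[symmetric] R.l_neg zero)
  qed (auto simp: S_eq zero[symmetric] add[symmetric] R.a_ac)
  have "rng S"
    by unfold_locales
      (auto simp: S_eq add[symmetric] mult[symmetric] R.m_closed R.m_assoc R.l_distr R.r_distr)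
  then show ?thesis
    by (intro rng_epi.intro rng_epi_axioms.intro) (simp_all add: \<open>rng R\<close> surj add mult)
qed

context rng
begin

lemma rad_proj_eq_iff:
  assumes "x \<in> carrier R" "y \<in> carrier R"
  shows "rad_proj R x = rad_proj R y \<longleftrightarrow> x \<ominus> y \<in> jacobson_radical R"
proof -
  interpret abelian_subgroup "jacobson_radical R" R
    by (rule abelian_subgroupI3[OF _ abelian_group_axioms])
      (use jacobson_radical_left_ideal in \<open>simp add: left_ideal_def\<close>)
  show ?thesis
  proof
    assume "rad_proj R x = rad_proj R y"
    then have "x \<in> rad_proj R y" using a_rcos_self[OF assms(1)] by (simp add: rad_proj_def)
    then obtain j where "j \<in> jacobson_radical R" "x = j \<oplus> y"
      by (auto simp: rad_proj_def a_r_coset_def')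
    then show "x \<ominus> y \<in> jacobson_radical R"
      using assms a_subset by (auto simp: rng_simps subset_iff)
  next
    assume j: "x \<ominus> y \<in> jacobson_radical R"
    have "x = (x \<ominus> y) \<oplus> y" using assms by (simp add: rng_simps)
    then have "x \<in> jacobson_radical R +> y" using j unfolding a_r_coset_def' by blast
    from a_repr_independence[OF this assms(2) a_subgroup]
    show "rad_proj R x = rad_proj R y" by (simp add: rad_proj_def)
  qed
qed

lemma rng_epi_rad_proj: "rng_epi R (rad_quotient R) (rad_proj R)"
proof (rule rng_epi_quotient[OF rng_axioms])
  let ?J = "jacobson_radical R"
  note J = jacobson_radical_left_ideal
  interpret J: abelian_subgroup ?J R
    by (rule abelian_subgroupI3[OF _ abelian_group_axioms])
      (use J in \<open>simp add: left_ideal_def\<close>)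
  show "rad_proj R ` carrier R = carrier (rad_quotient R)"
    by (auto simp: rad_proj_def rad_quotient_def FactRing_def A_RCOSETS_def')
  show "rad_proj R \<zero> = \<zero>\<^bsub>rad_quotient R\<^esub>"
    using left_ideal_subset[OF J] by (simp add: rad_proj_def rad_quotient_def FactRing_def)
  fix x y assume xy: "x \<in> carrier R" "y \<in> carrier R"
  show "rad_proj R (x \<oplus> y) = rad_proj R x \<oplus>\<^bsub>rad_quotient R\<^esub> rad_proj R y"
    using J.a_rcos_sum[OF xy] by (simp add: rad_proj_def rad_quotient_def FactRing_def)
  \<comment> \<open>The product of two classes is a union over representatives, so all of them must
    yield the same class. In \<open>u v - x y = u j + i y\<close> the second term needs the radical
    to absorb right factors.\<close>
  have "rad_proj R (u \<otimes> v) = rad_proj R (x \<otimes> y)" if uv: "u \<in> rad_proj R x" "v \<in> rad_proj R y" for u v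
  proof -
    obtain i j where ij: "i \<in> ?J" "j \<in> ?J" "u = i \<oplus> x" "v = j \<oplus> y"
      using uv by (auto simp: rad_proj_def a_r_coset_def')
    have c: "i \<in> carrier R" "j \<in> carrier R" using ij left_ideal_subset[OF J] by auto
    have "u \<otimes> v \<ominus> x \<otimes> y = (i \<oplus> x) \<otimes> j \<oplus> i \<otimes> y"
      using ij c xy by (simp add: rng_simps)
    also have "\<dots> \<in> ?J"
      using left_ideal_mult[OF J, of "i \<oplus> x" j] jacobson_radical_r_mult[OF ij(1) xy(2)] ij c xy
      by (intro left_ideal_add[OF J]) auto
    finally show ?thesis using ij c xy by (simp add: rad_proj_eq_iff m_closed)
  qed
  moreover have "x \<in> rad_proj R x" "y \<in> rad_proj R y"
    using xy J.a_rcos_self by (auto simp: rad_proj_def)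
  ultimately have "(\<Union>u\<in>rad_proj R x. \<Union>v\<in>rad_proj R y. rad_proj R (u \<otimes> v)) = rad_proj R (x \<otimes> y)"
    by blast
  then show "rad_proj R (x \<otimes> y) = rad_proj R x \<otimes>\<^bsub>rad_quotient R\<^esub> rad_proj R y"
    unfolding rad_quotient_def FactRing_def rcoset_mult_def rad_proj_def by simp
qed

lemma rad_proj_eq_zero_iff:
  assumes "x \<in> carrier R"
  shows "rad_proj R x = \<zero>\<^bsub>rad_quotient R\<^esub> \<longleftrightarrow> x \<in> jacobson_radical R"
proof -
  interpret pi: rng_epi R "rad_quotient R" "rad_proj R" by (rule rng_epi_rad_proj)
  show ?thesis
    using rad_proj_eq_iff[OF assms zero_closed] assms unfolding pi.hom_zero
    by (simp add: a_minus_def minus_zero)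
qed

text \<open>The kernel of the projection is the radical itself, so
  \<open>jacobson_radical_reflect\<close> brings a representative of a radical class back into the
  kernel.\<close>

lemma jacobson_radical_rad_quotient: "jacobson_radical (rad_quotient R) = {\<zero>\<^bsub>rad_quotient R\<^esub>}"
proof -
  interpret pi: rng_epi R "rad_quotient R" "rad_proj R" by (rule rng_epi_rad_proj)
  have "y = \<zero>\<^bsub>rad_quotient R\<^esub>" if y: "y \<in> jacobson_radical (rad_quotient R)" for y
  proof -
    have "y \<in> rad_proj R ` carrier R" using y unfolding pi.surj by (simp add: pi.S.jacobson_radical_iff)
    then obtain x where x: "x \<in> carrier R" "y = rad_proj R x" by blast
    then have "x \<in> jacobson_radical R"
      using y by (intro pi.jacobson_radical_reflect) (auto simp: rad_proj_eq_zero_iff)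
    then show ?thesis using x by (simp add: rad_proj_eq_zero_iff)
  qed
  then show ?thesis
    using pi.S.left_ideal_zero[OF pi.S.jacobson_radical_left_ideal] by blast
qed

text \<open>An automorphism maps the radical into itself, being an epimorphism of \<open>R\<close>
  onto \<open>R\<close>; this makes the choice of representative immaterial.\<close>

lemma induced_map_rad_proj:
  assumes "g \<in> rng_auto R" "x \<in> carrier R"
  shows "induced_map R (jacobson_radical R) g (rad_proj R x) = rad_proj R (g x)"
  unfolding rad_proj_def
proof (rule induced_map_coset[OF _ assms(1) _ assms(2)])
  show "additive_subgroup (jacobson_radical R) R"
    using jacobson_radical_left_ideal by (simp add: left_ideal_def)
  interpret g: rng_epi R R g by (rule rng_auto_epi[OF assms(1)])
  show "g ` jacobson_radical R \<subseteq> jacobson_radical R" using g.jacobson_radical_image by blast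
qed

lemma induced_map_auto:
  assumes g: "g \<in> rng_auto R"
  shows "induced_map R (jacobson_radical R) g \<in> rng_auto (rad_quotient R)" (is "?g \<in> _")
proof -
  interpret pi: rng_epi R "rad_quotient R" "rad_proj R" by (rule rng_epi_rad_proj)
  interpret g: rng_epi R R g by (rule rng_auto_epi[OF g])
  note val = induced_map_rad_proj[OF g]
  have "?g ` carrier (rad_quotient R) = rad_proj R ` g ` carrier R"
    unfolding pi.surj[symmetric] image_image by (rule image_cong) (simp_all add: val)
  then have onto: "?g ` carrier (rad_quotient R) = carrier (rad_quotient R)"
    using g.surj pi.surj by simp
  have inj_g: "inj_on g (carrier R)" using g by (auto simp: rng_auto_def Bij_def bij_betw_def)
  have "inj_on ?g (carrier (rad_quotient R))"
  proof (rule inj_onI)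
    fix u v assume "u \<in> carrier (rad_quotient R)" "v \<in> carrier (rad_quotient R)"
    then obtain x y where xy: "x \<in> carrier R" "y \<in> carrier R" "u = rad_proj R x" "v = rad_proj R y"
      unfolding pi.surj[symmetric] by blast
    assume "?g u = ?g v"
    then have "g (x \<ominus> y) \<in> jacobson_radical R"
      using xy by (simp add: val rad_proj_eq_iff g.hom_closed g.hom_diff)
    \<comment> \<open>As \<open>g\<close> is injective its kernel is zero, so membership in the
      radical can be reflected along \<open>g\<close>; this gives injectivity on classes.\<close>
    moreover have "{x \<in> carrier R. g x = \<zero>} \<subseteq> jacobson_radical R"
    proof clarify
      fix x assume "x \<in> carrier R" "g x = \<zero>"
      then have "x = \<zero>" using inj_onD[OF inj_g, of x \<zero>] g.hom_zero by simp
      then show "x \<in> jacobson_radical R" using left_ideal_zero[OF jacobson_radical_left_ideal] by simp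
    qed
    ultimately have "x \<ominus> y \<in> jacobson_radical R"
      using g.jacobson_radical_reflect xy by simp
    then show "u = v" using xy by (simp add: rad_proj_eq_iff)
  qed
  moreover have "?g \<in> extensional (carrier (rad_quotient R))"
    by (simp add: induced_map_def rad_quotient_def)
  moreover have "?g (u \<oplus>\<^bsub>rad_quotient R\<^esub> v) = ?g u \<oplus>\<^bsub>rad_quotient R\<^esub> ?g v \<and>
      ?g (u \<otimes>\<^bsub>rad_quotient R\<^esub> v) = ?g u \<otimes>\<^bsub>rad_quotient R\<^esub> ?g v"
    if "u \<in> carrier (rad_quotient R)" "v \<in> carrier (rad_quotient R)" for u v
  proof -
    have "u \<in> rad_proj R ` carrier R" "v \<in> rad_proj R ` carrier R" using that pi.surj by simp_all
    then obtain x y where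
        xy: "x \<in> carrier R" "y \<in> carrier R" "u = rad_proj R x" "v = rad_proj R y"
      by blast
    have "?g (rad_proj R (x \<oplus> y)) = rad_proj R (g x \<oplus> g y)"
      "?g (rad_proj R (x \<otimes> y)) = rad_proj R (g x \<otimes> g y)"
      using xy(1,2) by (simp_all add: val g.hom_add g.hom_mult m_closed)
    then show ?thesis
      using xy(1,2) unfolding xy(3,4)
      by (simp add: pi.hom_add pi.hom_mult val g.hom_closed)
  qed
  ultimately show ?thesis using onto by (simp add: rng_auto_def Bij_def bij_betw_def)
qed

text \<open>Transfers closure under composition from \<open>G\<close> to its image, which the orbit
  sums in the quotient need.\<close>

lemma compose_induced_map:
  assumes g: "g \<in> rng_auto R" and k: "k \<in> rng_auto R" and gk: "compose (carrier R) g k \<in> rng_auto R"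
  shows "compose (carrier (rad_quotient R)) (induced_map R (jacobson_radical R) g)
      (induced_map R (jacobson_radical R) k) =
    induced_map R (jacobson_radical R) (compose (carrier R) g k)"
proof (rule extensionalityI[of _ "carrier (rad_quotient R)"])
  interpret pi: rng_epi R "rad_quotient R" "rad_proj R" by (rule rng_epi_rad_proj)
  interpret k: rng_epi R R k by (rule rng_auto_epi[OF k])
  show "induced_map R (jacobson_radical R) (compose (carrier R) g k) \<in>
      extensional (carrier (rad_quotient R))"
    by (simp add: induced_map_def rad_quotient_def)
  fix u assume u: "u \<in> carrier (rad_quotient R)"
  then obtain x where "x \<in> carrier R" "u = rad_proj R x" unfolding pi.surj[symmetric] by blast
  then show "compose (carrier (rad_quotient R)) (induced_map R (jacobson_radical R) g)
      (induced_map R (jacobson_radical R) k) u =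
    induced_map R (jacobson_radical R) (compose (carrier R) g k) u"
    using u by (simp add: compose_eq induced_map_rad_proj g k gk k.hom_closed)
qed simp

end

section \<open>Comparing the invariants of \<open>R\<close> with those of its quotient\<close>

lemma subgroup_rng_AutoGroup:
  assumes "subgroup G (rng_AutoGroup R)"
  shows "G \<subseteq> rng_auto R"
    and "\<lbrakk>g \<in> G; k \<in> G\<rbrakk> \<Longrightarrow> compose (carrier R) g k \<in> G"
proof -
  show sub: "G \<subseteq> rng_auto R" using subgroup.subset[OF assms] by (simp add: rng_AutoGroup_def)
  assume "g \<in> G" "k \<in> G"
  then show "compose (carrier R) g k \<in> G"
    using subgroup.m_closed[OF assms, of g k] sub
    by (auto simp: rng_AutoGroup_def BijGroup_def rng_auto_def subset_iff)
qed

theorem theorem1p10: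
  fixes R :: "('a, 'b) ring_scheme" and G :: "('a \<Rightarrow> 'a) set"
  assumes "rng R"
    and "subgroup G (rng_AutoGroup R)" and "finite G"
    and "rad_proj R ` invariants R G = invariants (rad_quotient R) (induced_group R G)"
    and "left_proper_splitting_group (rad_quotient R) (induced_group R G)
      \<or> right_proper_splitting_group (rad_quotient R) (induced_group R G)"
    and "torsion_free (card (induced_group R G)) (rad_quotient R)
      \<or> (bad_primes (rad_quotient R) (induced_group R G) \<noteq> {}
          \<and> (\<forall>p\<in>bad_primes (rad_quotient R) (induced_group R G).
                has_p_normal_complement p (induced_group R G) (rng_AutoGroup (rad_quotient R))
              \<and> torsion_free (card (induced_group R G))
                  (invariant_ring (rad_quotient R) (induced_group R G))))"
  shows "jacobson_radical (invariant_ring R G) = jacobson_radical R \<inter> invariants R G"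
proof
  interpret rng R by fact
  let ?S = "rad_quotient R" and ?H = "induced_group R G"
  interpret pi: rng_epi R ?S "rad_proj R" by (rule rng_epi_rad_proj)
  note G = subgroup_rng_AutoGroup(1)[OF assms(2)]
  show "jacobson_radical R \<inter> invariants R G \<subseteq> jacobson_radical (invariant_ring R G)"
    by (rule jacobson_radical_inter_invariants[OF G])
  have H: "?H \<subseteq> rng_auto ?S" "finite ?H"
    using G induced_map_auto assms(3) by (auto simp: induced_group_def)
  have comp: "compose (carrier ?S) g h \<in> ?H" if gh: "g \<in> ?H" "h \<in> ?H" for g h
  proof -
    obtain g' h' where *: "g' \<in> G" "h' \<in> G" "g = induced_map R (jacobson_radical R) g'"
        "h = induced_map R (jacobson_radical R) h'"
      using gh by (auto simp: induced_group_def)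
    note gh' = subgroup_rng_AutoGroup(2)[OF assms(2) *(1,2)]
    have "compose (carrier ?S) g h = induced_map R (jacobson_radical R) (compose (carrier R) g' h')"
      unfolding *(3,4) using * G gh' by (intro compose_induced_map) auto
    then show ?thesis using gh' by (simp add: induced_group_def)
  qed
  \<comment> \<open>The projection restricted to invariants; it is onto by the hypothesis that the
    invariants of the quotient all lift.\<close>
  interpret T: rng_epi "invariant_ring R G" "invariant_ring ?S ?H" "rad_proj R"
    by (intro rng_epi.intro rng_epi_axioms.intro invariant_ring(1)[OF G]
        pi.S.invariant_ring(1)[OF H(1)])
      (use assms(4) in \<open>auto simp: invariant_ring_simps pi.S.invariant_ring_simps invariants_def
          pi.hom_add pi.hom_mult\<close>)
  show "jacobson_radical (invariant_ring R G) \<subseteq> jacobson_radical R \<inter> invariants R G"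
  proof
    fix a assume a: "a \<in> jacobson_radical (invariant_ring R G)"
    then have aG: "a \<in> invariants R G" by (simp add: T.R.jacobson_radical_iff invariant_ring_simps)
    then have ac: "a \<in> carrier R" by (simp add: invariants_def)
    let ?b = "rad_proj R a"
    have b: "?b \<in> invariants ?S ?H" using aG assms(4) by blast
    have "[card ?H] \<cdot>\<^bsub>?S\<^esub> ?b \<in> jacobson_radical ?S"
      using pi.S.card_jacobson_radical_invariants[OF H comp T.jacobson_radical_image[OF a]] .
    then have zero: "[card ?H] \<cdot>\<^bsub>?S\<^esub> ?b = \<zero>\<^bsub>?S\<^esub>" by (simp add: jacobson_radical_rad_quotient)
    then have "\<exists>i\<ge>1. [(card ?H ^ i)] \<cdot>\<^bsub>?S\<^esub> ?b = \<zero>\<^bsub>?S\<^esub>"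
      by (intro exI[of _ "1::nat"]) simp
    then have "?b \<in> tor (card ?H) ?S" "?b \<in> tor (card ?H) (invariant_ring ?S ?H)"
      using b pi.hom_closed[OF ac] by (simp_all add: tor_def pi.S.invariant_ring_simps)
    \<comment> \<open>In the second alternative the set of bad primes is nonempty, which lets the
      condition on the invariant ring be extracted from under the quantifier.\<close>
    moreover have "torsion_free (card ?H) ?S \<or> torsion_free (card ?H) (invariant_ring ?S ?H)"
      using assms(6) by blast
    ultimately have "?b = \<zero>\<^bsub>?S\<^esub>"
      by (auto simp: torsion_free_def pi.S.invariant_ring_simps)
    then show "a \<in> jacobson_radical R \<inter> invariants R G"
      using aG ac by (simp add: rad_proj_eq_zero_iff)
  qed
qed

end
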